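(* For every $n\geq 3$, the natural monomorphism $$\Lambda^n(A)\hookrightarrow H_n(A)$$ of functors of the abelian group $A$, induced by the Pontryagin product in homology, does not split naturally; that is, there is no natural transformation $H_n\to\Lambda^n$ of functors on the category of finitely generated abelian groups which is a left inverse to it.
   Context: For an abelian group $A$, $H_n(A)=H_n(K(A,1);\mathbb{Z})$ is its $n$-th integral group homology, and $\Lambda^n$ is the $n$-th exterior power. The monomorphism is obtained by identifying $A=H_1(A)$ and multiplying $n$ elements of $H_1(A)$ by means of the Pontryagin product on $H_*(A)$, which is induced by the addition $A\oplus A\to A$. All functors are regarded as functors from the category $\mathsf{Ab}$ of finitely generated abelian groups to itself. *)

theory Defs
  imports "HOL-Algebra.Algebra"
begin

section \<open>Finitely generated abelian groups and maps between quotients\<close>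

definition fg_abelian_group :: "'a monoid \<Rightarrow> bool" where
  "fg_abelian_group A \<longleftrightarrow>
     comm_group A \<and> (\<exists>S. finite S \<and> S \<subseteq> carrier A \<and> generate A S = carrier A)"

text \<open>If \<open>f\<close> is constant modulo \<open>N\<close> on the coset \<open>U\<close>, this is the common coset
  of its values: the map that \<open>f\<close> induces on a quotient group.\<close>

definition coset_map :: "'b monoid \<Rightarrow> 'b set \<Rightarrow> ('c \<Rightarrow> 'b) \<Rightarrow> 'c set \<Rightarrow> 'b set" where
  "coset_map G N f U = the_elem ((\<lambda>x. N #>\<^bsub>G\<^esub> f x) ` U)"

definition tuples :: "nat \<Rightarrow> 'a monoid \<Rightarrow> 'a list set" where
  "tuples n A = {xs. length xs = n \<and> set xs \<subseteq> carrier A}"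

definition tuple_map :: "('a \<Rightarrow> 'b) \<Rightarrow> ('a list \<Rightarrow>\<^sub>0 int) \<Rightarrow> ('b list \<Rightarrow>\<^sub>0 int)" where
  "tuple_map f = frag_extend (\<lambda>xs. frag_of (map f xs))"

section \<open>Integral group homology\<close>

text \<open>\<open>K(A,1)\<close> is modelled by the classifying simplicial set \<open>BA\<close> (the nerve of \<open>A\<close>), whose
  \<open>n\<close>-simplices \<open>[a\<^sub>1|\<dots>|a\<^sub>n]\<close> are the \<open>n\<close>-tuples in \<open>A\<close>. Its integral simplicial chain complex
  is the (unnormalised) bar complex of \<open>A\<close> with trivial coefficients.\<close>

definition bar_chain_group :: "nat \<Rightarrow> 'a monoid \<Rightarrow> ('a list \<Rightarrow>\<^sub>0 int) monoid" where
  "bar_chain_group n A = free_Abelian_group (tuples n A)"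

definition bar_face :: "'a monoid \<Rightarrow> nat \<Rightarrow> 'a list \<Rightarrow> 'a list" where
  "bar_face A i xs =
     (if i = 0 then tl xs
      else if i = length xs then butlast xs
      else take (i - 1) xs @ (xs ! (i - 1) \<otimes>\<^bsub>A\<^esub> xs ! i) # drop (i + 1) xs)"

definition bar_boundary :: "'a monoid \<Rightarrow> ('a list \<Rightarrow>\<^sub>0 int) \<Rightarrow> ('a list \<Rightarrow>\<^sub>0 int)" where
  "bar_boundary A = frag_extend
     (\<lambda>xs. if xs = [] then 0
           else \<Sum>i\<le>length xs. frag_cmul ((- 1) ^ i) (frag_of (bar_face A i xs)))"

definition bar_cycle_group :: "nat \<Rightarrow> 'a monoid \<Rightarrow> ('a list \<Rightarrow>\<^sub>0 int) monoid" where
  "bar_cycle_group n A =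
     subgroup_generated (bar_chain_group n A)
       {c \<in> carrier (bar_chain_group n A). bar_boundary A c = 0}"

definition bar_boundaries :: "nat \<Rightarrow> 'a monoid \<Rightarrow> ('a list \<Rightarrow>\<^sub>0 int) set" where
  "bar_boundaries n A = bar_boundary A ` carrier (bar_chain_group (Suc n) A)"

definition group_homology :: "nat \<Rightarrow> 'a monoid \<Rightarrow> ('a list \<Rightarrow>\<^sub>0 int) set monoid" where
  "group_homology n A = bar_cycle_group n A Mod bar_boundaries n A"

definition group_homology_map ::
  "nat \<Rightarrow> 'a monoid \<Rightarrow> 'b monoid \<Rightarrow> ('a \<Rightarrow> 'b) \<Rightarrow> ('a list \<Rightarrow>\<^sub>0 int) set \<Rightarrow> ('b list \<Rightarrow>\<^sub>0 int) set" where
  "group_homology_map n A B f =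
     coset_map (bar_cycle_group n B) (bar_boundaries n B) (tuple_map f)"

section \<open>The Pontryagin product\<close>

text \<open>The signed sum of all shuffles of two words; a letter of the second word that is
  moved past \<open>p\<close> letters of the first contributes the sign \<open>(-1)\<^sup>p\<close>.\<close>

fun shuffle_sum :: "'a list \<Rightarrow> 'a list \<Rightarrow> ('a list \<Rightarrow>\<^sub>0 int)" where
  "shuffle_sum [] ys = frag_of ys"
| "shuffle_sum (x # xs) [] = frag_of (x # xs)"
| "shuffle_sum (x # xs) (y # ys) =
     frag_extend (\<lambda>zs. frag_of (x # zs)) (shuffle_sum xs (y # ys))
     + frag_cmul ((- 1) ^ length (x # xs))
         (frag_extend (\<lambda>zs. frag_of (y # zs)) (shuffle_sum (x # xs) ys))"

text \<open>The Eilenberg--Zilber shuffle map from the tensor product of the chains of \<open>BA\<close> and \<open>BB\<close>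
  to the chains of \<open>B(A \<times> B)\<close>: the tuples \<open>xs\<close> and \<open>ys\<close> are included as \<open>(x,1)\<close> and \<open>(1,y)\<close>.\<close>

definition chain_cross ::
  "'a monoid \<Rightarrow> 'b monoid \<Rightarrow> ('a list \<Rightarrow>\<^sub>0 int) \<Rightarrow> ('b list \<Rightarrow>\<^sub>0 int) \<Rightarrow> (('a \<times> 'b) list \<Rightarrow>\<^sub>0 int)" where
  "chain_cross A B c d =
     frag_extend (\<lambda>xs. frag_extend (\<lambda>ys.
       shuffle_sum (map (\<lambda>x. (x, \<one>\<^bsub>B\<^esub>)) xs) (map (\<lambda>y. (\<one>\<^bsub>A\<^esub>, y)) ys)) d) c"

definition homology_cross ::
  "nat \<Rightarrow> nat \<Rightarrow> 'a monoid \<Rightarrow> 'b monoid \<Rightarrow> ('a list \<Rightarrow>\<^sub>0 int) set \<Rightarrow> ('b list \<Rightarrow>\<^sub>0 int) set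
     \<Rightarrow> (('a \<times> 'b) list \<Rightarrow>\<^sub>0 int) set" where
  "homology_cross p q A B U V =
     coset_map (bar_cycle_group (p + q) (A \<times>\<times> B)) (bar_boundaries (p + q) (A \<times>\<times> B))
       (\<lambda>(c, d). chain_cross A B c d) (U \<times> V)"

definition pontryagin ::
  "nat \<Rightarrow> nat \<Rightarrow> 'a monoid \<Rightarrow> ('a list \<Rightarrow>\<^sub>0 int) set \<Rightarrow> ('a list \<Rightarrow>\<^sub>0 int) set \<Rightarrow> ('a list \<Rightarrow>\<^sub>0 int) set" where
  "pontryagin p q A U V =
     group_homology_map (p + q) (A \<times>\<times> A) A (\<lambda>(a, b). a \<otimes>\<^bsub>A\<^esub> b) (homology_cross p q A A U V)"

text \<open>The identification of \<open>A\<close> with its first homology group.\<close>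

definition H1_class :: "'a monoid \<Rightarrow> 'a \<Rightarrow> ('a list \<Rightarrow>\<^sub>0 int) set" where
  "H1_class A a = bar_boundaries 1 A #>\<^bsub>bar_cycle_group 1 A\<^esub> frag_of [a]"

text \<open>The product of the degree-one classes of a list of elements; the empty product is the
  unit of the Pontryagin ring, the class of the vertex \<open>[]\<close>.\<close>

primrec pontryagin_prod :: "'a monoid \<Rightarrow> 'a list \<Rightarrow> ('a list \<Rightarrow>\<^sub>0 int) set" where
  "pontryagin_prod A [] = bar_boundaries 0 A #>\<^bsub>bar_cycle_group 0 A\<^esub> frag_of []"
| "pontryagin_prod A (a # as) =
     pontryagin 1 (length as) A (H1_class A a) (pontryagin_prod A as)"

section \<open>Exterior powers\<close>

text \<open>The \<open>n\<close>-th exterior power over the integers, presented as the free abelian group on \<open>n\<close>-tuples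
  (standing for \<open>a\<^sub>1 \<and> \<dots> \<and> a\<^sub>n\<close>) modulo multilinearity and vanishing on tuples with a repeated entry.\<close>

definition exterior_relators :: "nat \<Rightarrow> 'a monoid \<Rightarrow> ('a list \<Rightarrow>\<^sub>0 int) set" where
  "exterior_relators n A =
     {frag_of (xs[i := a \<otimes>\<^bsub>A\<^esub> b]) - frag_of (xs[i := a]) - frag_of (xs[i := b]) | xs i a b.
        xs \<in> tuples n A \<and> i < n \<and> a \<in> carrier A \<and> b \<in> carrier A}
     \<union> {frag_of xs | xs. xs \<in> tuples n A \<and> (\<exists>i j. i < j \<and> j < n \<and> xs ! i = xs ! j)}"

definition exterior_relations :: "nat \<Rightarrow> 'a monoid \<Rightarrow> ('a list \<Rightarrow>\<^sub>0 int) set" where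
  "exterior_relations n A =
     generate (free_Abelian_group (tuples n A)) (exterior_relators n A)"

definition exterior_power :: "nat \<Rightarrow> 'a monoid \<Rightarrow> ('a list \<Rightarrow>\<^sub>0 int) set monoid" where
  "exterior_power n A = free_Abelian_group (tuples n A) Mod exterior_relations n A"

definition exterior_power_map ::
  "nat \<Rightarrow> 'a monoid \<Rightarrow> 'b monoid \<Rightarrow> ('a \<Rightarrow> 'b) \<Rightarrow> ('a list \<Rightarrow>\<^sub>0 int) set \<Rightarrow> ('b list \<Rightarrow>\<^sub>0 int) set" where
  "exterior_power_map n A B f =
     coset_map (free_Abelian_group (tuples n B)) (exterior_relations n B) (tuple_map f)"

text \<open>The homomorphism from the exterior power to homology that sends \<open>a\<^sub>1 \<and> \<dots> \<and> a\<^sub>n\<close> to the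
  Pontryagin product of the classes of the \<open>a\<^sub>i\<close>: the \<open>finprod\<close> is the linear extension of
  \<open>pontryagin_prod\<close> to integral combinations \<open>c\<close> of tuples, with the target written
  multiplicatively.\<close>

definition exterior_to_homology ::
  "nat \<Rightarrow> 'a monoid \<Rightarrow> ('a list \<Rightarrow>\<^sub>0 int) set \<Rightarrow> ('a list \<Rightarrow>\<^sub>0 int) set" where
  "exterior_to_homology n A U =
     the_elem ((\<lambda>c. finprod (group_homology n A)
       (\<lambda>xs. pontryagin_prod A xs [^]\<^bsub>group_homology n A\<^esub> Poly_Mapping.lookup c xs)
       (Poly_Mapping.keys c)) ` U)"

section \<open>Natural transformations\<close>

text \<open>A functor from finitely generated abelian groups to abelian groups is given by its
  object part \<open>F\<close> and its morphism part \<open>F'\<close>, where \<open>F' A B f\<close> is the value at \<open>f: A \<rightarrow> B\<close>.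
  The objects range over all finitely generated abelian groups carried by a subset of \<open>'a\<close>;
  as these groups are countable, for infinite \<open>'a\<close> this category is equivalent to the
  category of all finitely generated abelian groups.\<close>

definition natural_transformation ::
  "('a monoid \<Rightarrow> 'b monoid) \<Rightarrow> ('a monoid \<Rightarrow> 'a monoid \<Rightarrow> ('a \<Rightarrow> 'a) \<Rightarrow> 'b \<Rightarrow> 'b) \<Rightarrow>
   ('a monoid \<Rightarrow> 'c monoid) \<Rightarrow> ('a monoid \<Rightarrow> 'a monoid \<Rightarrow> ('a \<Rightarrow> 'a) \<Rightarrow> 'c \<Rightarrow> 'c) \<Rightarrow>
   ('a monoid \<Rightarrow> 'b \<Rightarrow> 'c) \<Rightarrow> bool" where
  "natural_transformation F F' G G' \<tau> \<longleftrightarrow>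
     (\<forall>A. fg_abelian_group A \<longrightarrow> \<tau> A \<in> hom (F A) (G A)) \<and>
     (\<forall>A B f. fg_abelian_group A \<longrightarrow> fg_abelian_group B \<longrightarrow> f \<in> hom A B \<longrightarrow>
        (\<forall>x\<in>carrier (F A). \<tau> B (F' A B f x) = G' A B f (\<tau> A x)))"

end

theory Submission
  imports Defs "HOL-Library.Z2"
begin

text \<open>
  Write abelian groups additively. The bar complex of an abelian group is a differential graded
  algebra under the shuffle product \<open>*\<close>, and \<open>a\<^sub>1 \<and> \<dots> \<and> a\<^sub>n\<close> is sent to the class of
  \<open>[a\<^sub>1] * \<dots> * [a\<^sub>n]\<close>. The obstruction to a natural retraction is 2-torsion in degree three.
  If \<open>x + x = 0\<close>, the chain \<open>Y x = [x|x] + [0|0]\<close> has boundary \<open>2 [x]\<close>, so for two such elements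
  \<open>T x y = [x] * Y y + [y] * Y x\<close> is a 3-cycle; for independent \<open>x\<close> and \<open>y\<close> it generates the
  \<open>Tor\<close> summand of the third homology group of the subgroup \<open>\<langle>x\<rangle> \<times> \<langle>y\<rangle>\<close>. The map \<open>Y\<close> is not additive:
  \<open>Y (b + c) - Y b - Y c\<close> equals \<open>[b] * [c] - 2 [b|c]\<close> up to a boundary. In \<open>T\<close> the summand
  \<open>- 2 [b|c]\<close> is cancelled by the failure of additivity of \<open>x \<mapsto> [x]\<close>, and what remains is the
  polarization identity
  \<open>[a] * [b] * [c] \<sim> T a (b + c) - T a b - T a c\<close> (lemma \<open>triple_product_polarization\<close>).

  Let \<open>A\<close> be the vector space of dimension \<open>n\<close> over the field with two elements. Apply the
  identity to the last three vectors \<open>a, b, c\<close> of the standard basis and multiply it by the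
  others. The image of the wedge product of the basis becomes a combination of three classes,
  each of which comes from a hyperplane of \<open>A\<close>: the one where the \<open>c\<close>-coordinate vanishes, the one
  where the \<open>b\<close>-coordinate vanishes, and the one where these two coordinates agree. By naturality
  a transformation \<open>\<tau>\<close> from homology to the exterior power sends a class that comes from a
  hyperplane \<open>K\<close> into the image of \<open>\<Lambda>\<^sup>n K\<close> in \<open>\<Lambda>\<^sup>n A\<close>, and there the determinant vanishes because
  \<open>n\<close> vectors of \<open>K\<close> are linearly dependent (lemma \<open>natural_transformation_vanishes_on_subgroup\<close>).
  Hence the determinant vanishes on the value of \<open>\<tau>\<close> at the image of the wedge product of the basis.
  If \<open>\<tau>\<close> were a left inverse, this value would be the wedge product itself, with determinant 1.

  Evaluating the map from the exterior power to homology requires the Pontryagin product on cycles: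
  the Leibniz rule \<open>bar_boundary_shuffle\<close> makes it well defined on classes, and
  \<open>exterior_to_homology_class\<close> expresses the map through iterated shuffle products.
\<close>

section \<open>Linear maps between free abelian groups\<close>

lemmas frag_extend_linear =
  frag_extend_add frag_extend_diff frag_extend_minus frag_extend_cmul

lemma frag_extend_add_fun:
  "frag_extend (\<lambda>w. f w + g w) c = frag_extend f c + frag_extend g c"
  by (simp add: frag_extend_def frag_cmul_distrib2 sum.distrib)

lemma frag_cmul_diff_right: "frag_cmul k (a - b) = frag_cmul k a - frag_cmul k b"
  by (rule poly_mapping_eqI) (simp add: lookup_minus algebra_simps)

lemma frag_extend_cmul_fun:
  "frag_extend (\<lambda>w. frag_cmul k (f w)) c = frag_cmul k (frag_extend f c)"
  by (simp add: frag_extend_def frag_cmul_sum mult.commute)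

lemma frag_extend_minus_fun:
  "frag_extend (\<lambda>w. - f w) c = - frag_extend f c"
  using frag_extend_cmul_fun[of "-1" f c] by simp

lemma frag_extend_diff_fun:
  "frag_extend (\<lambda>w. f w - g w) c = frag_extend f c - frag_extend g c"
  using frag_extend_add_fun[of f "\<lambda>w. - g w" c] by (simp add: frag_extend_minus_fun)

lemma frag_extend_zero_fun: "frag_extend (\<lambda>w. 0) c = 0"
  by (simp add: frag_extend_def)

lemma frag_extend_frag_extend:
  "frag_extend f (frag_extend g c) = frag_extend (\<lambda>w. frag_extend f (g w)) c"
  by (simp add: frag_extend_def[of g] frag_extend_def[of "\<lambda>w. frag_extend f (g w)"]
      frag_extend_sum frag_extend_cmul)

section \<open>The boundary of the bar complex by recursion on words\<close>

definition cons_chain :: "'a \<Rightarrow> ('a list \<Rightarrow>\<^sub>0 int) \<Rightarrow> ('a list \<Rightarrow>\<^sub>0 int)" where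
  "cons_chain x = frag_extend (\<lambda>w. frag_of (x # w))"

text \<open>Leaving the empty word unchanged is the right convention for the last face: for the word
  \<open>[x]\<close> it deletes \<open>x\<close>, so that \<open>x # w\<close> contributes \<open>mult_head A x w\<close> whether or not \<open>w\<close> is empty.\<close>

fun mult_head :: "'a monoid \<Rightarrow> 'a \<Rightarrow> 'a list \<Rightarrow> 'a list" where
  "mult_head A x [] = []"
| "mult_head A x (y # w) = (x \<otimes>\<^bsub>A\<^esub> y) # w"

definition mult_head_chain :: "'a monoid \<Rightarrow> 'a \<Rightarrow> ('a list \<Rightarrow>\<^sub>0 int) \<Rightarrow> ('a list \<Rightarrow>\<^sub>0 int)" where
  "mult_head_chain A x = frag_extend (\<lambda>w. frag_of (mult_head A x w))"

text \<open>The face of index zero, extended linearly; the 0-simplex \<open>[]\<close> has none.\<close>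

definition drop_head :: "('a list \<Rightarrow>\<^sub>0 int) \<Rightarrow> ('a list \<Rightarrow>\<^sub>0 int)" where
  "drop_head = frag_extend (\<lambda>w. if w = [] then 0 else frag_of (tl w))"

text \<open>The signed sum of the faces of positive index. The first of them multiplies the leading two
  letters, and the others keep the leading letter and act as faces on the rest of the word with
  the opposite sign.\<close>

fun inner_faces :: "'a monoid \<Rightarrow> 'a list \<Rightarrow> ('a list \<Rightarrow>\<^sub>0 int)" where
  "inner_faces A [] = 0"
| "inner_faces A (x # w) = - frag_of (mult_head A x w) - cons_chain x (inner_faces A w)"

definition inner_boundary :: "'a monoid \<Rightarrow> ('a list \<Rightarrow>\<^sub>0 int) \<Rightarrow> ('a list \<Rightarrow>\<^sub>0 int)" where
  "inner_boundary A = frag_extend (inner_faces A)"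

lemma cons_chain_simps [simp]:
  "cons_chain x 0 = 0" "cons_chain x (frag_of w) = frag_of (x # w)"
  "cons_chain x (c + d) = cons_chain x c + cons_chain x d"
  "cons_chain x (c - d) = cons_chain x c - cons_chain x d"
  "cons_chain x (- c) = - cons_chain x c"
  "cons_chain x (frag_cmul k c) = frag_cmul k (cons_chain x c)"
  by (simp_all add: cons_chain_def frag_extend_linear)

lemma mult_head_chain_simps [simp]:
  "mult_head_chain A x 0 = 0" "mult_head_chain A x (frag_of w) = frag_of (mult_head A x w)"
  "mult_head_chain A x (c + d) = mult_head_chain A x c + mult_head_chain A x d"
  "mult_head_chain A x (c - d) = mult_head_chain A x c - mult_head_chain A x d"
  "mult_head_chain A x (- c) = - mult_head_chain A x c"
  "mult_head_chain A x (frag_cmul k c) = frag_cmul k (mult_head_chain A x c)"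
  by (simp_all add: mult_head_chain_def frag_extend_linear)

lemma drop_head_simps [simp]:
  "drop_head 0 = 0" "drop_head (frag_of []) = 0" "drop_head (frag_of (x # w)) = frag_of w"
  "drop_head (c + d) = drop_head c + drop_head d"
  "drop_head (c - d) = drop_head c - drop_head d"
  "drop_head (- c) = - drop_head c"
  "drop_head (frag_cmul k c) = frag_cmul k (drop_head c)"
  by (simp_all add: drop_head_def frag_extend_linear)

lemma inner_boundary_simps [simp]:
  "inner_boundary A 0 = 0" "inner_boundary A (frag_of w) = inner_faces A w"
  "inner_boundary A (c + d) = inner_boundary A c + inner_boundary A d"
  "inner_boundary A (c - d) = inner_boundary A c - inner_boundary A d"
  "inner_boundary A (- c) = - inner_boundary A c"
  "inner_boundary A (frag_cmul k c) = frag_cmul k (inner_boundary A c)"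
  by (simp_all add: inner_boundary_def frag_extend_linear)

lemma chain_induct [case_names zero word diff]:
  assumes "P 0" "\<And>w. P (frag_of w)" "\<And>a b. P a \<Longrightarrow> P b \<Longrightarrow> P (a - b)"
  shows "P c"
  using subset_UNIV by (rule frag_induction) (use assms in auto)

lemma drop_head_cons [simp]: "drop_head (cons_chain x c) = c"
  by (induction c rule: chain_induct) auto

lemma inner_boundary_cons [simp]:
  "inner_boundary A (cons_chain x c) = - mult_head_chain A x c - cons_chain x (inner_boundary A c)"
proof (induction c rule: chain_induct)
  case (diff a b)
  then show ?case by simp
qed auto

lemma mult_head_chain_cons [simp]:
  "mult_head_chain A x (cons_chain y c) = cons_chain (x \<otimes>\<^bsub>A\<^esub> y) c"
  by (induction c rule: chain_induct) auto

text \<open>The face of index zero is the only one that does not fit into a recursion which strips the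
  leading letter; splitting it off makes both the square of the boundary and the Leibniz rule
  provable by structural induction.\<close>

lemma sum_faces:
  "(\<Sum>i\<le>length w. frag_cmul ((- 1) ^ i) (frag_of (bar_face A i w)))
     = frag_of (tl w) + inner_faces A w" if "w \<noteq> []"
  using that
proof (induction w)
  case (Cons x w)
  have *: "(\<Sum>i\<le>length (x # w). frag_cmul ((- 1) ^ i) (frag_of (bar_face A i (x # w))))
     = frag_of w + (\<Sum>i\<le>length w. frag_cmul ((- 1) ^ Suc i) (frag_of (bar_face A (Suc i) (x # w))))"
    by (simp del: power_Suc sum.atMost_Suc add: sum.atMost_Suc_shift) (simp add: bar_face_def)
  show ?case
  proof (cases "w = []")
    case True
    then show ?thesis by (simp add: bar_face_def)
  next
    case False
    then obtain m where m: "length w = Suc m" by (cases w) auto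
    have face: "bar_face A (Suc (Suc i)) (x # w) = x # bar_face A (Suc i) w" if "i \<le> m" for i
      using that m by (auto simp: bar_face_def butlast_conv_take)
    have "(\<Sum>i\<le>length w. frag_cmul ((- 1) ^ Suc i) (frag_of (bar_face A (Suc i) (x # w))))
        = - frag_of (mult_head A x w)
          + (\<Sum>i\<le>m. frag_cmul ((- 1) ^ i) (cons_chain x (frag_of (bar_face A (Suc i) w))))"
    proof -
      have "bar_face A 1 (x # w) = mult_head A x w"
        using m by (cases w) (auto simp: bar_face_def)
      then show ?thesis
        by (simp del: sum.atMost_Suc add: m sum.atMost_Suc_shift face cong: sum.cong_simp)
    qed
    also have "(\<Sum>i\<le>m. frag_cmul ((- 1) ^ i) (cons_chain x (frag_of (bar_face A (Suc i) w))))
        = - cons_chain x (\<Sum>i\<le>m. frag_cmul ((- 1) ^ Suc i) (frag_of (bar_face A (Suc i) w)))"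
      by (simp add: cons_chain_def frag_extend_sum o_def frag_extend_cmul sum_negf[symmetric])
    also have "(\<Sum>i\<le>m. frag_cmul ((- 1) ^ Suc i) (frag_of (bar_face A (Suc i) w)))
        = (\<Sum>i\<le>length w. frag_cmul ((- 1) ^ i) (frag_of (bar_face A i w))) - frag_of (tl w)"
      by (simp del: power_Suc sum.atMost_Suc add: m sum.atMost_Suc_shift) (simp add: bar_face_def)
    finally show ?thesis using Cons.IH[OF False] * by simp
  qed
qed auto

lemma bar_boundary_eq: "bar_boundary A c = drop_head c + inner_boundary A c"
proof -
  have "bar_boundary A c = frag_extend (\<lambda>w. (if w = [] then 0 else frag_of (tl w)) + inner_faces A w) c"
    unfolding bar_boundary_def by (rule frag_extend_eq) (auto simp: sum_faces simp del: sum.atMost_Suc)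
  then show ?thesis by (simp add: frag_extend_add_fun drop_head_def inner_boundary_def)
qed

lemma bar_boundary_simps [simp]:
  "bar_boundary A 0 = 0"
  "bar_boundary A (c + d) = bar_boundary A c + bar_boundary A d"
  "bar_boundary A (c - d) = bar_boundary A c - bar_boundary A d"
  "bar_boundary A (- c) = - bar_boundary A c"
  "bar_boundary A (frag_cmul k c) = frag_cmul k (bar_boundary A c)"
  by (simp_all add: bar_boundary_def frag_extend_linear)

lemma length_mult_head [simp]: "length (mult_head A x w) = length w"
  by (cases w) auto

lemma keys_frag_extend_subset:
  "(\<And>w. w \<in> Poly_Mapping.keys c \<Longrightarrow> Poly_Mapping.keys (f w) \<subseteq> S) \<Longrightarrow> Poly_Mapping.keys (frag_extend f c) \<subseteq> S"
  using keys_frag_extend[of f c] by blast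

lemma keys_add_subset:
  "Poly_Mapping.keys c \<subseteq> S \<Longrightarrow> Poly_Mapping.keys d \<subseteq> S \<Longrightarrow> Poly_Mapping.keys (c + d) \<subseteq> S"
  using keys_add[of c d] by blast

lemma keys_diff_subset:
  "Poly_Mapping.keys c \<subseteq> S \<Longrightarrow> Poly_Mapping.keys d \<subseteq> S \<Longrightarrow> Poly_Mapping.keys (c - d) \<subseteq> S"
  using keys_diff[of c d] by blast

lemma keys_cmul_subset:
  "Poly_Mapping.keys c \<subseteq> S \<Longrightarrow> Poly_Mapping.keys (frag_cmul k c) \<subseteq> S"
  using keys_cmul[of k c] by blast

lemma keys_cons_chain:
  "Poly_Mapping.keys c \<subseteq> S \<Longrightarrow> (\<And>w. w \<in> S \<Longrightarrow> x # w \<in> S') \<Longrightarrow> Poly_Mapping.keys (cons_chain x c) \<subseteq> S'"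
  unfolding cons_chain_def by (rule keys_frag_extend_subset) auto

lemma set_mult_head:
  "\<lbrakk>monoid A; x \<in> carrier A; set w \<subseteq> carrier A\<rbrakk> \<Longrightarrow> set (mult_head A x w) \<subseteq> carrier A"
  by (cases w) (auto intro: monoid.m_closed)

lemma length_keys_inner_faces:
  "Poly_Mapping.keys (inner_faces A w) \<subseteq> {v. Suc (length v) = length w}"
proof (induction w)
  case (Cons x w)
  have "Poly_Mapping.keys (cons_chain x (inner_faces A w)) \<subseteq> {v. Suc (length v) = length (x # w)}"
    by (rule keys_cons_chain[OF Cons.IH]) auto
  then show ?case by (simp add: keys_diff_subset)
qed simp

lemma keys_inner_faces:
  assumes "monoid A" "w \<in> tuples (Suc n) A"
  shows "Poly_Mapping.keys (inner_faces A w) \<subseteq> tuples n A"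
  using assms(2)
proof (induction w arbitrary: n)
  case (Cons x w)
  have "Poly_Mapping.keys (cons_chain x (inner_faces A w)) \<subseteq> tuples n A"
  proof (cases n)
    case 0
    with Cons show ?thesis by (simp add: tuples_def)
  next
    case (Suc m)
    have "Poly_Mapping.keys (inner_faces A w) \<subseteq> tuples m A"
      using Cons Suc by (auto simp: tuples_def)
    then show ?thesis
      by (rule keys_cons_chain) (use Suc Cons.prems in \<open>auto simp: tuples_def\<close>)
  qed
  moreover have "mult_head A x w \<in> tuples n A"
    using Cons.prems set_mult_head[OF assms(1)] by (auto simp: tuples_def)
  ultimately show ?case by (simp add: keys_diff_subset)
qed simp

lemma keys_bar_boundary:
  assumes "monoid A" "Poly_Mapping.keys c \<subseteq> tuples (Suc n) A"
  shows "Poly_Mapping.keys (bar_boundary A c) \<subseteq> tuples n A"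
  unfolding bar_boundary_eq
proof (rule keys_add_subset)
  show "Poly_Mapping.keys (drop_head c) \<subseteq> tuples n A"
    unfolding drop_head_def
    by (rule keys_frag_extend_subset) (use assms(2) in \<open>auto simp: tuples_def dest: list.set_sel(2)\<close>)
  show "Poly_Mapping.keys (inner_boundary A c) \<subseteq> tuples n A"
    unfolding inner_boundary_def
    by (rule keys_frag_extend_subset) (use assms keys_inner_faces in blast)
qed

text \<open>For a word \<open>x # y # v\<close> the two ways of multiplying \<open>x\<close>, \<open>y\<close> and the head of \<open>v\<close> appear with
  opposite signs and agree by associativity.\<close>

lemma inner_faces_inner_faces:
  assumes "monoid A" "set w \<subseteq> carrier A"
  shows "inner_boundary A (inner_faces A w) = 0"
  using assms(2)
proof (induction w)
  case (Cons x w)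
  show ?case
  proof (cases w)
    case (Cons y v)
    have "mult_head A (x \<otimes>\<^bsub>A\<^esub> y) v = mult_head A x (mult_head A y v)"
      using Cons.prems Cons assms(1) by (cases v) (auto simp: monoid.m_assoc)
    moreover have "inner_faces A (mult_head A y v)
        = mult_head_chain A y (inner_faces A v) + cons_chain y (inner_boundary A (inner_faces A v))"
      using Cons.IH Cons.prems Cons by (simp add: algebra_simps)
    ultimately show ?thesis using Cons by simp
  qed simp
qed simp

text \<open>Multiplying a letter onto a word changes only the head, which \<open>drop_head\<close> removes again; so the
  terms that involve \<open>drop_head\<close> cancel among themselves.\<close>

lemma bar_boundary_bar_boundary:
  assumes "monoid A" "Poly_Mapping.keys c \<subseteq> tuples n A"
  shows "bar_boundary A (bar_boundary A c) = 0"
  using assms(2)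
proof (induction c rule: frag_induction)
  case (one w)
  have "drop_head (frag_of (mult_head A x v)) = drop_head (frag_of v)" for x v
    by (cases v) auto
  then show ?case
    using one inner_faces_inner_faces[OF assms(1), of w]
    by (cases w) (auto simp: bar_boundary_eq tuples_def)
qed auto

section \<open>The shuffle product and the Leibniz rule\<close>

definition shuffle :: "('a list \<Rightarrow>\<^sub>0 int) \<Rightarrow> ('a list \<Rightarrow>\<^sub>0 int) \<Rightarrow> ('a list \<Rightarrow>\<^sub>0 int)" where
  "shuffle c d = frag_extend (\<lambda>xs. frag_extend (shuffle_sum xs) d) c"

lemma shuffle_simps [simp]:
  "shuffle 0 d = 0" "shuffle c 0 = 0" "shuffle (frag_of xs) (frag_of ys) = shuffle_sum xs ys"
  "shuffle (c + c') d = shuffle c d + shuffle c' d" "shuffle c (d + d') = shuffle c d + shuffle c d'"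
  "shuffle (c - c') d = shuffle c d - shuffle c' d" "shuffle c (d - d') = shuffle c d - shuffle c d'"
  "shuffle (- c) d = - shuffle c d" "shuffle c (- d) = - shuffle c d"
  "shuffle (frag_cmul k c) d = frag_cmul k (shuffle c d)"
  "shuffle c (frag_cmul k d) = frag_cmul k (shuffle c d)"
  by (simp_all add: shuffle_def frag_extend_linear frag_extend_add_fun frag_extend_diff_fun
      frag_extend_minus_fun frag_extend_cmul_fun frag_extend_zero_fun)

lemma shuffle_sum_Nil [simp]: "shuffle_sum xs [] = frag_of xs"
  by (cases xs) auto

lemma shuffle_Nil [simp]: "shuffle c (frag_of []) = c" "shuffle (frag_of []) c = c"
  by (induction c rule: chain_induct) auto

lemma shuffle_sum_Cons_Cons [simp]:
  "shuffle_sum (x # xs) (y # ys) = cons_chain x (shuffle_sum xs (y # ys))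
     + frag_cmul ((- 1) ^ Suc (length xs)) (cons_chain y (shuffle_sum (x # xs) ys))"
  by (simp add: cons_chain_def)

declare shuffle_sum.simps(3) [simp del]

text \<open>The sign depends on the length of the words on the left, hence the chain has to be
  homogeneous; here \<open>m\<close> is the length of the words in \<open>cons_chain x c\<close>.\<close>

lemma shuffle_cons_left:
  assumes "Poly_Mapping.keys c \<subseteq> {w. Suc (length w) = m}"
  shows "shuffle (cons_chain x c) (frag_of (y # ys)) = cons_chain x (shuffle c (frag_of (y # ys)))
     + frag_cmul ((- 1) ^ m) (cons_chain y (shuffle (cons_chain x c) (frag_of ys)))"
  using assms by (induction c rule: frag_induction) (auto simp: frag_cmul_diff_right)

lemma shuffle_cons_right:
  "shuffle (frag_of (x # xs)) (cons_chain y c) = cons_chain x (shuffle (frag_of xs) (cons_chain y c))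
     + frag_cmul ((- 1) ^ Suc (length xs)) (cons_chain y (shuffle (frag_of (x # xs)) c))"
  by (induction c rule: chain_induct) (auto simp: frag_cmul_diff_right)

lemma keys_shuffle_sum:
  "Poly_Mapping.keys (shuffle_sum xs ys)
     \<subseteq> {zs. length zs = length xs + length ys \<and> set zs \<subseteq> set xs \<union> set ys}"
proof (induction xs ys rule: shuffle_sum.induct)
  case (3 x xs y ys)
  show ?case
    unfolding shuffle_sum_Cons_Cons
    by (intro keys_add_subset keys_cmul_subset keys_cons_chain[OF "3"(1)] keys_cons_chain[OF "3"(2)]) auto
qed auto

lemma keys_shuffle:
  assumes "Poly_Mapping.keys c \<subseteq> tuples p A" "Poly_Mapping.keys d \<subseteq> tuples q A"
  shows "Poly_Mapping.keys (shuffle c d) \<subseteq> tuples (p + q) A"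
  unfolding shuffle_def
  using assms keys_shuffle_sum
  by (intro keys_frag_extend_subset) (fastforce simp: tuples_def)

text \<open>If the head of a word of the shuffle comes from \<open>xs\<close>, multiplying it by \<open>x\<close> amounts to shuffling
  \<open>mult_head A x xs\<close> instead; the last two terms correct the words with head \<open>y\<close>. The products
  \<open>x \<otimes> y\<close> that arise there cancel in the Leibniz rule against the products \<open>y \<otimes> x\<close> of the next lemma.\<close>

lemma mult_head_shuffle_left:
  "mult_head_chain A x (shuffle_sum xs (y # ys)) = shuffle_sum (mult_head A x xs) (y # ys)
     + frag_cmul ((- 1) ^ length xs) (cons_chain (x \<otimes>\<^bsub>A\<^esub> y) (shuffle_sum xs ys)
         - cons_chain y (shuffle_sum (mult_head A x xs) ys))"
  by (cases xs) (simp_all add: frag_cmul_diff_right)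

lemma mult_head_shuffle_right:
  "mult_head_chain A y (shuffle_sum (x # xs) ys) = shuffle_sum (x # xs) (mult_head A y ys)
     + cons_chain (y \<otimes>\<^bsub>A\<^esub> x) (shuffle_sum xs ys)
     - cons_chain x (shuffle_sum xs (mult_head A y ys))"
  by (cases ys) simp_all

lemma drop_head_shuffle_sum:
  "drop_head (shuffle_sum xs ys) = shuffle (drop_head (frag_of xs)) (frag_of ys)
     + frag_cmul ((- 1) ^ length xs) (shuffle (frag_of xs) (drop_head (frag_of ys)))"
  by (cases xs; cases ys) simp_all

text \<open>Letters of different factors have to commute: the faces that multiply a letter of \<open>xs\<close> with an
  adjacent letter of \<open>ys\<close> cancel in pairs, one for each order of the two letters.\<close>

lemma inner_boundary_shuffle_sum:
  assumes "\<And>x y. x \<in> set xs \<Longrightarrow> y \<in> set ys \<Longrightarrow> x \<otimes>\<^bsub>A\<^esub> y = y \<otimes>\<^bsub>A\<^esub> x"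
  shows "inner_boundary A (shuffle_sum xs ys) = shuffle (inner_faces A xs) (frag_of ys)
     + frag_cmul ((- 1) ^ length xs) (shuffle (frag_of xs) (inner_faces A ys))"
  using assms
proof (induction xs ys rule: shuffle_sum.induct)
  case (3 x xs y ys)
  have IH1: "inner_boundary A (shuffle_sum xs (y # ys)) = shuffle (inner_faces A xs) (frag_of (y # ys))
     + frag_cmul ((- 1) ^ length xs) (shuffle (frag_of xs) (inner_faces A (y # ys)))"
    using 3 by auto
  have IH2: "inner_boundary A (shuffle_sum (x # xs) ys) = shuffle (inner_faces A (x # xs)) (frag_of ys)
     + frag_cmul ((- 1) ^ Suc (length xs)) (shuffle (frag_of (x # xs)) (inner_faces A ys))"
    using 3 by auto
  have comm: "y \<otimes>\<^bsub>A\<^esub> x = x \<otimes>\<^bsub>A\<^esub> y"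
    using "3.prems"[of x y] by simp
  have sign: "(- 1) ^ length xs = (1::int) \<or> (- 1) ^ length xs = (-1::int)"
    by (cases "even (length xs)") auto
  note left = shuffle_cons_left[OF length_keys_inner_faces, of x A xs]
  note right = shuffle_cons_right[of x xs]
  show ?case
    using sign
    by (elim disjE)
      (simp_all add: IH1 IH2 comm mult_head_shuffle_left mult_head_shuffle_right left right
        del: inner_faces.simps(2) shuffle_sum.simps,
       simp_all add: inner_faces.simps(2) left right)
qed simp_all

lemma bar_boundary_shuffle:
  assumes "comm_group A" "Poly_Mapping.keys c \<subseteq> tuples p A" "Poly_Mapping.keys d \<subseteq> tuples q A"
  shows "bar_boundary A (shuffle c d)
     = shuffle (bar_boundary A c) d + frag_cmul ((- 1) ^ p) (shuffle c (bar_boundary A d))"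
  using assms(2)
proof (induction c rule: frag_induction)
  case (one xs)
  show ?case
    using assms(3)
  proof (induction d rule: frag_induction)
    case (one ys)
    have "inner_boundary A (shuffle_sum xs ys) = shuffle (inner_faces A xs) (frag_of ys)
        + frag_cmul ((- 1) ^ length xs) (shuffle (frag_of xs) (inner_faces A ys))"
      using one \<open>xs \<in> tuples p A\<close> assms(1)
      by (intro inner_boundary_shuffle_sum)
        (auto simp: tuples_def intro!: comm_monoid.m_comm dest: comm_group.axioms(1))
    with \<open>xs \<in> tuples p A\<close> show ?case
      by (simp add: bar_boundary_eq drop_head_shuffle_sum frag_cmul_distrib2 tuples_def)
  qed (auto simp: frag_cmul_diff_right)
qed (auto simp: frag_cmul_diff_right)

section \<open>Maps induced by homomorphisms\<close>

lemma tuple_map_simps [simp]: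
  "tuple_map f 0 = 0" "tuple_map f (frag_of xs) = frag_of (map f xs)"
  "tuple_map f (c + d) = tuple_map f c + tuple_map f d"
  "tuple_map f (c - d) = tuple_map f c - tuple_map f d"
  "tuple_map f (- c) = - tuple_map f c"
  "tuple_map f (frag_cmul k c) = frag_cmul k (tuple_map f c)"
  by (simp_all add: tuple_map_def frag_extend_linear)

lemma tuple_map_tuple_map: "tuple_map g (tuple_map f c) = tuple_map (g \<circ> f) c"
  by (induction c rule: chain_induct) (auto simp: comp_def)

lemma tuple_map_id_on:
  assumes "Poly_Mapping.keys c \<subseteq> tuples n A" "\<And>x. x \<in> carrier A \<Longrightarrow> f x = x"
  shows "tuple_map f c = c"
  using assms(1)
proof (induction c rule: frag_induction)
  case (one w)
  then have "map f w = w"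
    using assms(2) by (intro map_idI) (auto simp: tuples_def)
  then show ?case by simp
qed auto

lemma keys_tuple_map:
  assumes "Poly_Mapping.keys c \<subseteq> tuples n A" "f ` carrier A \<subseteq> carrier B"
  shows "Poly_Mapping.keys (tuple_map f c) \<subseteq> tuples n B"
  unfolding tuple_map_def
  by (rule keys_frag_extend_subset) (use assms in \<open>auto 4 4 simp: tuples_def\<close>)

lemma tuple_map_cons_chain: "tuple_map f (cons_chain x c) = cons_chain (f x) (tuple_map f c)"
  by (induction c rule: chain_induct) auto

lemma tuple_map_shuffle_sum: "tuple_map f (shuffle_sum xs ys) = shuffle_sum (map f xs) (map f ys)"
  by (induction xs ys rule: shuffle_sum.induct) (simp_all add: tuple_map_cons_chain)

lemma tuple_map_shuffle: "tuple_map f (shuffle c d) = shuffle (tuple_map f c) (tuple_map f d)"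
proof (induction c rule: chain_induct)
  case (word xs)
  show ?case
    by (induction d rule: chain_induct) (auto simp: tuple_map_shuffle_sum)
qed auto

lemma bar_boundary_tuple_map:
  assumes "f \<in> hom A B" "Poly_Mapping.keys c \<subseteq> tuples n A"
  shows "bar_boundary B (tuple_map f c) = tuple_map f (bar_boundary A c)"
proof -
  have inner: "inner_faces B (map f w) = tuple_map f (inner_faces A w)" if "set w \<subseteq> carrier A" for w
    using that
  proof (induction w)
    case (Cons x w)
    have "mult_head B (f x) (map f w) = map f (mult_head A x w)"
      using Cons.prems assms(1) by (cases w) (auto simp: hom_mult)
    with Cons show ?case by (simp add: tuple_map_cons_chain)
  qed simp
  from assms(2) show ?thesis
  proof (induction c rule: frag_induction)
    case (one w)
    then show ?case
      using inner[of w] by (cases w) (auto simp: bar_boundary_eq tuples_def)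
  qed auto
qed

text \<open>The cross product is the shuffle product inside the bar complex of \<open>A \<times> B\<close>, so it inherits the
  Leibniz rule from there.\<close>

lemma chain_cross_eq:
  "chain_cross A B c d
     = shuffle (tuple_map (\<lambda>x. (x, \<one>\<^bsub>B\<^esub>)) c) (tuple_map (\<lambda>y. (\<one>\<^bsub>A\<^esub>, y)) d)"
  by (simp add: chain_cross_def shuffle_def tuple_map_def frag_extend_frag_extend)

section \<open>Shuffle products with one letter\<close>

lemma shuffle_one_cons:
  "shuffle (frag_of [x]) (cons_chain y c) = cons_chain x (cons_chain y c) - cons_chain y (shuffle (frag_of [x]) c)"
  using shuffle_cons_right[of x "[]" y c] by simp

text \<open>One-letter words anticommute strictly, not only up to a boundary; the same holds for
  the vanishing of squares below.\<close>

lemma shuffle_one_anticommute: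
  "shuffle (frag_of [x]) (shuffle (frag_of [y]) c) = - shuffle (frag_of [y]) (shuffle (frag_of [x]) c)"
proof (induction c rule: chain_induct)
  case (word w)
  show ?case
  proof (induction w)
    case (Cons z w)
    then show ?case
      by (simp add: shuffle_one_cons)
  qed simp
qed auto

lemma shuffle_one_square: "shuffle (frag_of [x]) (shuffle (frag_of [x]) c) = 0"
proof (induction c rule: chain_induct)
  case (word w)
  show ?case
    by (induction w) (simp_all add: shuffle_one_cons)
qed auto

section \<open>A polarization identity in degree three\<close>

text \<open>The chain \<open>Y x\<close> of the introduction. The degenerate word corrects \<open>[x|x]\<close>, whose boundary is
  \<open>2 [x] - [1]\<close> if \<open>x\<close> is an involution.\<close>

definition doubling_chain :: "'a monoid \<Rightarrow> 'a \<Rightarrow> ('a list \<Rightarrow>\<^sub>0 int)" where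
  "doubling_chain A x = frag_of [x, x] + frag_of [\<one>\<^bsub>A\<^esub>, \<one>\<^bsub>A\<^esub>]"

text \<open>A representative of the generator of the summand \<open>Tor (H\<^sub>1 \<langle>x\<rangle>) (H\<^sub>1 \<langle>y\<rangle>)\<close> in the third homology group of the
  product of the cyclic groups of order two generated by \<open>x\<close> and \<open>y\<close>.\<close>

definition torsion_cycle :: "'a monoid \<Rightarrow> 'a \<Rightarrow> 'a \<Rightarrow> ('a list \<Rightarrow>\<^sub>0 int)" where
  "torsion_cycle A x y = shuffle (frag_of [x]) (doubling_chain A y) + shuffle (frag_of [y]) (doubling_chain A x)"

lemma bar_boundary_one [simp]: "bar_boundary A (frag_of [x]) = 0"
  by (simp add: bar_boundary_eq)

lemma bar_boundary_doubling_chain: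
  assumes "monoid A" "x \<otimes>\<^bsub>A\<^esub> x = \<one>\<^bsub>A\<^esub>"
  shows "bar_boundary A (doubling_chain A x) = frag_cmul 2 (frag_of [x])"
proof -
  have "frag_cmul 2 (frag_of [x]) = frag_of [x] + frag_of [x]"
    using frag_cmul_distrib[of 1 1 "frag_of [x]"] by simp
  with assms show ?thesis
    by (simp add: doubling_chain_def bar_boundary_eq monoid.l_one)
qed

lemma keys_doubling_chain:
  "\<lbrakk>monoid A; x \<in> carrier A\<rbrakk> \<Longrightarrow> Poly_Mapping.keys (doubling_chain A x) \<subseteq> tuples 2 A"
  unfolding doubling_chain_def by (intro keys_add_subset) (auto simp: tuples_def)

lemma keys_word: "set w \<subseteq> carrier A \<Longrightarrow> length w = n \<Longrightarrow> Poly_Mapping.keys (frag_of w) \<subseteq> tuples n A"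
  by (auto simp: tuples_def)

lemma keys_torsion_cycle:
  assumes "monoid A" "x \<in> carrier A" "y \<in> carrier A"
  shows "Poly_Mapping.keys (torsion_cycle A x y) \<subseteq> tuples 3 A"
  unfolding torsion_cycle_def
  using keys_shuffle[OF keys_word[of "[x]" A 1] keys_doubling_chain[of A y]]
        keys_shuffle[OF keys_word[of "[y]" A 1] keys_doubling_chain[of A x]] assms
  by (intro keys_add_subset) (auto simp: numeral_3_eq_3 numeral_2_eq_2)

text \<open>The boundary is \<open>- 2 ([x] * [y] + [y] * [x])\<close>, and \<open>[x]\<close> and \<open>[y]\<close> anticommute.\<close>

lemma bar_boundary_torsion_cycle:
  assumes A: "comm_group A" and "x \<in> carrier A" "y \<in> carrier A"
    and "x \<otimes>\<^bsub>A\<^esub> x = \<one>\<^bsub>A\<^esub>" "y \<otimes>\<^bsub>A\<^esub> y = \<one>\<^bsub>A\<^esub>"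
  shows "bar_boundary A (torsion_cycle A x y) = 0"
proof -
  have m: "monoid A" using A by (simp add: comm_group.axioms comm_monoid.axioms)
  have "bar_boundary A (shuffle (frag_of [x]) (doubling_chain A y)) = frag_cmul (-2) (shuffle_sum [x] [y])"
    if "x \<in> carrier A" "y \<in> carrier A" "y \<otimes>\<^bsub>A\<^esub> y = \<one>\<^bsub>A\<^esub>" for x y
    using that bar_boundary_shuffle[OF A keys_word[of "[x]" A 1] keys_doubling_chain[OF m, of y]]
    by (simp add: bar_boundary_doubling_chain[OF m] del: shuffle_sum.simps shuffle_sum_Cons_Cons)
  with assms show ?thesis
    by (simp add: torsion_cycle_def frag_cmul_distrib2 frag_cmul_diff_right)
qed

text \<open>Both \<open>x \<mapsto> [x]\<close> and \<open>x \<mapsto> Y x\<close> are additive only up to correction terms. With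
  \<open>s = [b|c]\<close> they read \<open>[b] + [c] - [b c] = d s\<close> and \<open>Y (b c) - Y b - Y c = [b] * [c] - 2 s + d t\<close>.
  Substituting these into \<open>T a (b c)\<close> produces \<open>T a b + T a c + [a] * [b] * [c]\<close>, the terms
  \<open>- 2 [a] * s\<close> and \<open>2 s * [a]\<close>, which cancel, and boundaries of products.\<close>

lemma triple_product_polarization:
  assumes A: "comm_group A" and abc: "a \<in> carrier A" "b \<in> carrier A" "c \<in> carrier A"
    and sq: "a \<otimes>\<^bsub>A\<^esub> a = \<one>\<^bsub>A\<^esub>" "b \<otimes>\<^bsub>A\<^esub> b = \<one>\<^bsub>A\<^esub>" "c \<otimes>\<^bsub>A\<^esub> c = \<one>\<^bsub>A\<^esub>"
  obtains w where "Poly_Mapping.keys w \<subseteq> tuples 4 A"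
    "shuffle (frag_of [a]) (shuffle (frag_of [b]) (frag_of [c]))
       = torsion_cycle A a (b \<otimes>\<^bsub>A\<^esub> c) - torsion_cycle A a b - torsion_cycle A a c + bar_boundary A w"
proof
  interpret comm_group A by fact
  \<comment> \<open>The boundaries of \<open>[c|c|b]\<close> and \<open>[b|c|b c]\<close> share the face \<open>[c|b c]\<close>, which cancels; the latter also
    contains \<open>[b c|b c]\<close> and, as \<open>c (b c) = b\<close>, the word \<open>[b|b]\<close>. The second word of \<open>t\<close> removes
    the degenerate faces that remain.\<close>
  define s where "s = frag_of [b, c]"
  define t where "t = frag_of [c, c, b] + frag_of [\<one>\<^bsub>A\<^esub>, \<one>\<^bsub>A\<^esub>, b] - frag_of [b, c, b \<otimes>\<^bsub>A\<^esub> c]"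
  let ?Y = "doubling_chain A"
  let ?X = "\<lambda>x. shuffle (frag_of [x])"
  let ?w = "shuffle s (?Y a) + ?X a t"
  have ks: "Poly_Mapping.keys s \<subseteq> tuples 2 A"
    unfolding s_def by (rule keys_word) (use abc in auto)
  have kt: "Poly_Mapping.keys t \<subseteq> tuples 3 A"
    unfolding t_def by (intro keys_add_subset keys_diff_subset keys_word) (use abc in auto)
  have ka: "Poly_Mapping.keys (frag_of [a]) \<subseteq> tuples 1 A"
    by (rule keys_word) (use abc in auto)
  have kY: "Poly_Mapping.keys (?Y a) \<subseteq> tuples 2 A"
    by (rule keys_doubling_chain) (use abc in auto)
  show "Poly_Mapping.keys ?w \<subseteq> tuples 4 A"
    using keys_shuffle[OF ks kY] keys_shuffle[OF ka kt] by (intro keys_add_subset) auto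
  have bcc: "c \<otimes>\<^bsub>A\<^esub> (b \<otimes>\<^bsub>A\<^esub> c) = b"
    using abc sq by (metis m_assoc m_comm r_one)
  have two: "frag_cmul 2 z = z + z" for z :: "'a list \<Rightarrow>\<^sub>0 int"
    using frag_cmul_distrib[of 1 1 z] by simp
  have ds: "bar_boundary A s = frag_of [b] + frag_of [c] - frag_of [b \<otimes>\<^bsub>A\<^esub> c]"
    by (simp add: s_def bar_boundary_eq)
  have dt: "bar_boundary A t
      = ?Y (b \<otimes>\<^bsub>A\<^esub> c) - ?Y b - ?Y c + frag_cmul 2 s - ?X b (frag_of [c])"
    using abc sq bcc m_comm[of c b]
    by (simp add: t_def s_def bar_boundary_eq doubling_chain_def two)
  have dsY: "bar_boundary A (shuffle s (?Y a))
      = ?X b (?Y a) + ?X c (?Y a) - ?X (b \<otimes>\<^bsub>A\<^esub> c) (?Y a) + frag_cmul 2 (shuffle s (frag_of [a]))"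
    using bar_boundary_shuffle[OF A ks kY] sq by (simp add: ds bar_boundary_doubling_chain)
  have dXt: "bar_boundary A (?X a t) = ?X a (?X b (frag_of [c])) - ?X a (?Y (b \<otimes>\<^bsub>A\<^esub> c))
      + ?X a (?Y b) + ?X a (?Y c) - frag_cmul 2 (?X a s)"
    using bar_boundary_shuffle[OF A ka kt] unfolding dt by simp
  have "shuffle s (frag_of [a]) = ?X a s"
    by (simp add: s_def)
  with dsY dXt show "?X a (?X b (frag_of [c]))
       = torsion_cycle A a (b \<otimes>\<^bsub>A\<^esub> c) - torsion_cycle A a b - torsion_cycle A a c + bar_boundary A ?w"
    by (simp add: torsion_cycle_def)
qed

section \<open>Cosets in additive groups\<close>

text \<open>The cosets below are formed in several groups of chains that differ in their carriers but share
  addition as operation. A coset depends on the operation alone, so a notion of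
  subgroup that does not mention the ambient group serves all of them.\<close>

definition diff_closed :: "'a::group_add set \<Rightarrow> bool" where
  "diff_closed N \<longleftrightarrow> 0 \<in> N \<and> (\<forall>x\<in>N. \<forall>y\<in>N. x - y \<in> N)"

lemma diff_closedD:
  assumes "diff_closed N"
  shows "0 \<in> N" "x \<in> N \<Longrightarrow> y \<in> N \<Longrightarrow> x - y \<in> N" "x \<in> N \<Longrightarrow> - x \<in> N"
    "x \<in> N \<Longrightarrow> y \<in> N \<Longrightarrow> x + y \<in> N"
proof -
  show 0: "0 \<in> N" and diff: "x \<in> N \<Longrightarrow> y \<in> N \<Longrightarrow> x - y \<in> N" for x y
    using assms by (auto simp: diff_closed_def)
  show neg: "x \<in> N \<Longrightarrow> - x \<in> N" for x
    using diff[OF 0] by simp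
  show "x \<in> N \<Longrightarrow> y \<in> N \<Longrightarrow> x + y \<in> N"
    using diff[OF _ neg] by fastforce
qed

lemma r_coset_additive:
  "monoid.mult G = (+) \<Longrightarrow> N #>\<^bsub>G\<^esub> c = (\<lambda>h. h + c) ` N"
  by (auto simp: r_coset_def)

lemma r_coset_additive_eq:
  fixes c d :: "'a::ab_group_add"
  assumes "monoid.mult G = (+)" "diff_closed N" "c - d \<in> N"
  shows "N #>\<^bsub>G\<^esub> c = N #>\<^bsub>G\<^esub> d"
proof -
  have *: "(\<lambda>h. h + c) ` N \<subseteq> (\<lambda>h. h + d) ` N" if "c - d \<in> N" for c d
  proof
    fix x assume "x \<in> (\<lambda>h. h + c) ` N"
    then obtain h where h: "h \<in> N" "x = h + c" by auto
    then have "x = (h + (c - d)) + d" "h + (c - d) \<in> N"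
      using that diff_closedD(4)[OF assms(2)] by simp_all
    then show "x \<in> (\<lambda>h. h + d) ` N" by blast
  qed
  have "d - c \<in> N"
    using diff_closedD(3)[OF assms(2,3)] by simp
  with * assms(3) show ?thesis
    unfolding r_coset_additive[OF assms(1)] by blast
qed

text \<open>The set of cosets whose element is selected by \<open>coset_map\<close> is a singleton as soon as \<open>f\<close> varies
  within one coset; it is enough to compare with one representative.\<close>

lemma coset_map_eq:
  fixes f :: "'c \<Rightarrow> 'b::ab_group_add"
  assumes "monoid.mult G = (+)" "diff_closed N" "u \<in> U" "\<And>x. x \<in> U \<Longrightarrow> f x - f u \<in> N"
  shows "coset_map G N f U = N #>\<^bsub>G\<^esub> f u"
proof -
  have "(\<lambda>x. N #>\<^bsub>G\<^esub> f x) ` U = (\<lambda>x. N #>\<^bsub>G\<^esub> f u) ` U"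
    using r_coset_additive_eq[OF assms(1,2) assms(4)] by (rule image_cong[OF refl])
  also have "\<dots> = {N #>\<^bsub>G\<^esub> f u}"
    using assms(3) by blast
  finally show ?thesis by (simp add: coset_map_def)
qed

lemma set_mult_additive_cosets:
  fixes c d :: "'a::ab_group_add"
  assumes "monoid.mult G = (+)" "diff_closed N"
  shows "(N #>\<^bsub>G\<^esub> c) <#>\<^bsub>G\<^esub> (N #>\<^bsub>G\<^esub> d) = N #>\<^bsub>G\<^esub> (c + d)"
proof (rule subset_antisym; rule subsetI)
  fix x assume "x \<in> (N #>\<^bsub>G\<^esub> c) <#>\<^bsub>G\<^esub> (N #>\<^bsub>G\<^esub> d)"
  then obtain h k where hk: "h \<in> N" "k \<in> N" "x = (h + c) + (k + d)"
    unfolding set_mult_def r_coset_additive[OF assms(1)] using assms(1) by auto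
  then have "x = (h + k) + (c + d)" "h + k \<in> N"
    using diff_closedD(4)[OF assms(2)] by (simp_all add: algebra_simps)
  then show "x \<in> N #>\<^bsub>G\<^esub> (c + d)"
    unfolding r_coset_additive[OF assms(1)] by blast
next
  fix x assume "x \<in> N #>\<^bsub>G\<^esub> (c + d)"
  then obtain h where h: "h \<in> N" "x = h + (c + d)"
    unfolding r_coset_additive[OF assms(1)] by blast
  then have "x = (h + c) + (0 + d)" by (simp add: algebra_simps)
  with h show "x \<in> (N #>\<^bsub>G\<^esub> c) <#>\<^bsub>G\<^esub> (N #>\<^bsub>G\<^esub> d)"
    unfolding set_mult_def r_coset_additive[OF assms(1)]
    using assms(1) diff_closedD(1)[OF assms(2)] by fastforce
qed

lemma mult_free_Abelian_group_eq: "monoid.mult (free_Abelian_group S) = (+)"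
  by (simp add: free_Abelian_group_def)

lemma mult_bar_cycle_group: "monoid.mult (bar_cycle_group n A) = (+)"
  by (simp add: bar_cycle_group_def bar_chain_group_def mult_free_Abelian_group_eq)

lemma subgroup_free_Abelian_groupI:
  assumes "diff_closed N" "\<And>c. c \<in> N \<Longrightarrow> Poly_Mapping.keys c \<subseteq> S"
  shows "subgroup N (free_Abelian_group S)"
proof
  show "x \<otimes>\<^bsub>free_Abelian_group S\<^esub> y \<in> N" if "x \<in> N" "y \<in> N" for x y
    using that diff_closedD(4)[OF assms(1)] by simp
  show "inv\<^bsub>free_Abelian_group S\<^esub> x \<in> N" if "x \<in> N" for x
    using that assms(2) diff_closedD(3)[OF assms(1)] by simp
qed (use assms diff_closedD(1)[OF assms(1)] in auto)

section \<open>Homology classes\<close>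

definition bar_cycles :: "nat \<Rightarrow> 'a monoid \<Rightarrow> ('a list \<Rightarrow>\<^sub>0 int) set" where
  "bar_cycles n A = {c. Poly_Mapping.keys c \<subseteq> tuples n A \<and> bar_boundary A c = 0}"

definition homology_class :: "nat \<Rightarrow> 'a monoid \<Rightarrow> ('a list \<Rightarrow>\<^sub>0 int) \<Rightarrow> ('a list \<Rightarrow>\<^sub>0 int) set" where
  "homology_class n A c = bar_boundaries n A #>\<^bsub>bar_cycle_group n A\<^esub> c"

lemma diff_closed_bar_cycles: "diff_closed (bar_cycles n A)"
  unfolding diff_closed_def bar_cycles_def using keys_diff_subset by auto

lemma bar_cycles_cmul: "c \<in> bar_cycles n A \<Longrightarrow> frag_cmul k c \<in> bar_cycles n A"
  by (simp add: bar_cycles_def keys_cmul_subset)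

lemma bar_boundaries_eq:
  "bar_boundaries n A = bar_boundary A ` {c. Poly_Mapping.keys c \<subseteq> tuples (Suc n) A}"
  by (auto simp: bar_boundaries_def bar_chain_group_def)

lemma diff_closed_bar_boundaries: "diff_closed (bar_boundaries n A)"
  unfolding diff_closed_def bar_boundaries_eq
proof (intro conjI ballI)
  show "0 \<in> bar_boundary A ` {c. Poly_Mapping.keys c \<subseteq> tuples (Suc n) A}"
    by (rule image_eqI[of _ _ 0]) auto
  fix x y
  assume "x \<in> bar_boundary A ` {c. Poly_Mapping.keys c \<subseteq> tuples (Suc n) A}"
    "y \<in> bar_boundary A ` {c. Poly_Mapping.keys c \<subseteq> tuples (Suc n) A}"
  then obtain c d where "Poly_Mapping.keys c \<subseteq> tuples (Suc n) A" "x = bar_boundary A c"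
      "Poly_Mapping.keys d \<subseteq> tuples (Suc n) A" "y = bar_boundary A d"
    by blast
  then show "x - y \<in> bar_boundary A ` {c. Poly_Mapping.keys c \<subseteq> tuples (Suc n) A}"
    by (intro image_eqI[of _ _ "c - d"]) (simp_all add: keys_diff_subset)
qed

lemma bar_boundaries_subset_cycles:
  "monoid A \<Longrightarrow> bar_boundaries n A \<subseteq> bar_cycles n A"
  unfolding bar_boundaries_eq bar_cycles_def
  by (intro image_subsetI CollectI conjI; drule CollectD)
    (simp_all add: keys_bar_boundary bar_boundary_bar_boundary[of A _ "Suc n"])

lemma bar_boundariesI: "Poly_Mapping.keys c \<subseteq> tuples (Suc n) A \<Longrightarrow> bar_boundary A c \<in> bar_boundaries n A"
  by (auto simp: bar_boundaries_eq)

lemma subgroup_bar_cycles: "subgroup (bar_cycles n A) (bar_chain_group n A)"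
  unfolding bar_chain_group_def
  by (rule subgroup_free_Abelian_groupI[OF diff_closed_bar_cycles]) (auto simp: bar_cycles_def)

lemma bar_cycle_group_eq: "bar_cycle_group n A = subgroup_generated (bar_chain_group n A) (bar_cycles n A)"
  by (simp add: bar_cycle_group_def bar_cycles_def bar_chain_group_def)

lemma carrier_bar_cycle_group: "carrier (bar_cycle_group n A) = bar_cycles n A"
  unfolding bar_cycle_group_eq
  by (rule subgroup.carrier_subgroup_generated_subgroup[OF subgroup_bar_cycles])

lemma comm_group_bar_cycle_group: "comm_group (bar_cycle_group n A)"
  unfolding bar_cycle_group_def bar_chain_group_def
  by (rule group.abelian_subgroup_generated) (simp_all add: abelian_free_Abelian_group)

lemma subgroup_bar_boundaries:
  assumes "monoid A"
  shows "subgroup (bar_boundaries n A) (bar_cycle_group n A)"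
  unfolding bar_cycle_group_eq
proof (rule group.subgroup_of_subgroup_generated)
  show "subgroup (bar_boundaries n A) (bar_chain_group n A)"
    unfolding bar_chain_group_def
    by (rule subgroup_free_Abelian_groupI[OF diff_closed_bar_boundaries])
      (use bar_boundaries_subset_cycles[OF assms] in \<open>auto simp: bar_cycles_def\<close>)
qed (use bar_boundaries_subset_cycles[OF assms] in \<open>auto simp: bar_chain_group_def\<close>)

lemma comm_group_homology: "monoid A \<Longrightarrow> comm_group (group_homology n A)"
  unfolding group_homology_def
  by (rule comm_group.abelian_FactGroup[OF comm_group_bar_cycle_group subgroup_bar_boundaries])

lemma carrier_group_homology: "carrier (group_homology n A) = homology_class n A ` bar_cycles n A"
  by (simp add: group_homology_def carrier_FactGroup homology_class_def carrier_bar_cycle_group)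

lemma homology_class_add:
  "homology_class n A c \<otimes>\<^bsub>group_homology n A\<^esub> homology_class n A d = homology_class n A (c + d)"
  by (simp add: group_homology_def homology_class_def
      set_mult_additive_cosets[OF mult_bar_cycle_group diff_closed_bar_boundaries])

lemma one_group_homology: "\<one>\<^bsub>group_homology n A\<^esub> = homology_class n A 0"
  by (simp add: group_homology_def homology_class_def r_coset_additive[OF mult_bar_cycle_group])

lemma homology_class_eqI:
  "c - d \<in> bar_boundaries n A \<Longrightarrow> homology_class n A c = homology_class n A d"
  unfolding homology_class_def
  by (rule r_coset_additive_eq[OF mult_bar_cycle_group diff_closed_bar_boundaries])

lemma mem_homology_class_iff: "x \<in> homology_class n A c \<longleftrightarrow> x - c \<in> bar_boundaries n A"
  unfolding homology_class_def r_coset_additive[OF mult_bar_cycle_group]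
  by (auto simp: image_iff) (metis diff_add_cancel)

lemma homology_class_int_pow:
  assumes "monoid A" "c \<in> bar_cycles n A"
  shows "homology_class n A c [^]\<^bsub>group_homology n A\<^esub> (k::int) = homology_class n A (frag_cmul k c)"
proof -
  interpret H: comm_group "group_homology n A"
    using assms(1) by (rule comm_group_homology)
  have cl: "homology_class n A (frag_cmul j c) \<in> carrier (group_homology n A)" for j
    using bar_cycles_cmul[OF assms(2)] by (simp add: carrier_group_homology)
  have c: "homology_class n A c \<in> carrier (group_homology n A)"
    using cl[of 1] by simp
  have nat: "homology_class n A c [^]\<^bsub>group_homology n A\<^esub> (m::nat) = homology_class n A (frag_cmul (int m) c)" for m
    by (induction m) (auto simp: one_group_homology homology_class_add frag_cmul_distrib algebra_simps)
  show ?thesis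
  proof (cases k rule: int_cases2)
    case (nonneg m)
    then show ?thesis by (simp add: int_pow_int nat)
  next
    case (nonpos m)
    have "homology_class n A (frag_cmul (int m) c) \<otimes>\<^bsub>group_homology n A\<^esub> homology_class n A (frag_cmul (- int m) c)
        = \<one>\<^bsub>group_homology n A\<^esub>"
      by (simp add: homology_class_add one_group_homology flip: frag_cmul_distrib)
    then have "inv\<^bsub>group_homology n A\<^esub> (homology_class n A (frag_cmul (int m) c)) = homology_class n A (frag_cmul (- int m) c)"
      using cl by (metis H.inv_equality H.m_comm)
    then show ?thesis
      using nonpos c by (simp add: H.int_pow_neg int_pow_int nat)
  qed
qed

lemma finprod_homology_class:
  assumes "monoid A" "finite F" "\<And>x. x \<in> F \<Longrightarrow> g x \<in> bar_cycles n A"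
  shows "finprod (group_homology n A) (\<lambda>x. homology_class n A (g x)) F = homology_class n A (sum g F)"
proof -
  interpret H: comm_group "group_homology n A"
    using assms(1) by (rule comm_group_homology)
  show ?thesis
    using assms(2,3)
  proof (induction F rule: finite_induct)
    case empty
    then show ?case by (simp add: one_group_homology)
  next
    case (insert x F)
    then have "(\<lambda>x. homology_class n A (g x)) \<in> F \<rightarrow> carrier (group_homology n A)"
      "homology_class n A (g x) \<in> carrier (group_homology n A)"
      by (auto simp: carrier_group_homology)
    then show ?case
      using insert by (simp add: homology_class_add)
  qed
qed

lemma group_homology_map_class:
  assumes "f \<in> hom A B" "c \<in> bar_cycles n A"
  shows "group_homology_map n A B f (homology_class n A c) = homology_class n B (tuple_map f c)"
  unfolding group_homology_map_def homology_class_def[of n B]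
proof (rule coset_map_eq[OF mult_bar_cycle_group diff_closed_bar_boundaries])
  show "c \<in> homology_class n A c"
    by (simp add: mem_homology_class_iff diff_closedD(1)[OF diff_closed_bar_boundaries])
  fix x assume "x \<in> homology_class n A c"
  then obtain w where w: "Poly_Mapping.keys w \<subseteq> tuples (Suc n) A" "x - c = bar_boundary A w"
    by (auto simp: mem_homology_class_iff bar_boundaries_eq)
  then have "tuple_map f x - tuple_map f c = bar_boundary B (tuple_map f w)"
    using bar_boundary_tuple_map[OF assms(1) w(1)] by (simp flip: tuple_map_simps)
  then show "tuple_map f x - tuple_map f c \<in> bar_boundaries n B"
    using keys_tuple_map[OF w(1), of f B] assms(1) by (auto simp: hom_def intro!: bar_boundariesI)
qed

section \<open>The Pontryagin product of homology classes\<close>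

lemma comm_group_DirProd:
  assumes "comm_group A" "comm_group B"
  shows "comm_group (A \<times>\<times> B)"
proof (rule group.group_comm_groupI)
  show "group (A \<times>\<times> B)"
    using assms by (intro DirProd_group) (auto simp: comm_group_def)
next
  fix x y assume "x \<in> carrier (A \<times>\<times> B)" "y \<in> carrier (A \<times>\<times> B)"
  then show "x \<otimes>\<^bsub>A \<times>\<times> B\<^esub> y = y \<otimes>\<^bsub>A \<times>\<times> B\<^esub> x"
    using comm_groupE(4)[OF assms(1), of "fst x" "fst y"] comm_groupE(4)[OF assms(2), of "snd x" "snd y"]
    by (cases x; cases y) simp
qed

lemma chain_cross_chain_map:
  assumes "comm_group A" "comm_group B" "Poly_Mapping.keys c \<subseteq> tuples p A" "Poly_Mapping.keys d \<subseteq> tuples q B"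
  shows "Poly_Mapping.keys (chain_cross A B c d) \<subseteq> tuples (p + q) (A \<times>\<times> B)"
    and "bar_boundary (A \<times>\<times> B) (chain_cross A B c d) = chain_cross A B (bar_boundary A c) d
      + frag_cmul ((- 1) ^ p) (chain_cross A B c (bar_boundary B d))"
proof -
  let ?l = "\<lambda>x. (x, \<one>\<^bsub>B\<^esub>)" and ?r = "\<lambda>y. (\<one>\<^bsub>A\<^esub>, y)"
  have m: "monoid A" "monoid B"
    using assms by (simp_all add: comm_group.axioms comm_monoid.axioms)
  then have h: "?l \<in> hom A (A \<times>\<times> B)" "?r \<in> hom B (A \<times>\<times> B)"
    by (auto simp: hom_def monoid.one_closed monoid.l_one)
  have k: "Poly_Mapping.keys (tuple_map ?l c) \<subseteq> tuples p (A \<times>\<times> B)"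
      "Poly_Mapping.keys (tuple_map ?r d) \<subseteq> tuples q (A \<times>\<times> B)"
    using keys_tuple_map[OF assms(3), of ?l "A \<times>\<times> B"] keys_tuple_map[OF assms(4), of ?r "A \<times>\<times> B"] h
    by (auto simp: hom_def)
  show "Poly_Mapping.keys (chain_cross A B c d) \<subseteq> tuples (p + q) (A \<times>\<times> B)"
    unfolding chain_cross_eq by (rule keys_shuffle[OF k])
  show "bar_boundary (A \<times>\<times> B) (chain_cross A B c d) = chain_cross A B (bar_boundary A c) d
      + frag_cmul ((- 1) ^ p) (chain_cross A B c (bar_boundary B d))"
    unfolding chain_cross_eq
    using bar_boundary_shuffle[OF comm_group_DirProd[OF assms(1,2)] k]
      bar_boundary_tuple_map[OF h(1) assms(3)] bar_boundary_tuple_map[OF h(2) assms(4)] by simp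
qed

text \<open>Changing the factors by boundaries \<open>d v\<close> and \<open>d w\<close> changes the product by
  \<open>(d v) \<times> y + c \<times> (d w)\<close>, where \<open>c\<close> and \<open>y\<close> are cycles; by the Leibniz rule this is a boundary.\<close>

lemma homology_cross_class:
  assumes A: "comm_group A" and B: "comm_group B" and c: "c \<in> bar_cycles p A" and d: "d \<in> bar_cycles q B"
  shows "homology_cross p q A B (homology_class p A c) (homology_class q B d)
     = homology_class (p + q) (A \<times>\<times> B) (chain_cross A B c d)"
proof -
  let ?N = "bar_boundaries (p + q) (A \<times>\<times> B)"
  let ?f = "\<lambda>(c, d). chain_cross A B c d"
  have m: "monoid A" "monoid B"
    using A B by (simp_all add: comm_group.axioms comm_monoid.axioms)
  have "coset_map (bar_cycle_group (p + q) (A \<times>\<times> B)) ?N ?f (homology_class p A c \<times> homology_class q B d)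
      = ?N #>\<^bsub>bar_cycle_group (p + q) (A \<times>\<times> B)\<^esub> ?f (c, d)"
  proof (rule coset_map_eq[OF mult_bar_cycle_group diff_closed_bar_boundaries])
    show "(c, d) \<in> homology_class p A c \<times> homology_class q B d"
      by (simp add: mem_homology_class_iff diff_closedD(1)[OF diff_closed_bar_boundaries])
    fix z assume "z \<in> homology_class p A c \<times> homology_class q B d"
    then obtain x y where z: "z = (x, y)" "x \<in> homology_class p A c" "y \<in> homology_class q B d"
      by auto
    then obtain v w where v: "Poly_Mapping.keys v \<subseteq> tuples (Suc p) A" "x - c = bar_boundary A v"
        and w: "Poly_Mapping.keys w \<subseteq> tuples (Suc q) B" "y - d = bar_boundary B w"
      by (auto simp: mem_homology_class_iff bar_boundaries_eq)
    have xy: "x = c + bar_boundary A v" "y = d + bar_boundary B w"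
      using v(2) w(2) by (simp_all add: algebra_simps)
    have kc: "Poly_Mapping.keys c \<subseteq> tuples p A" and kd: "Poly_Mapping.keys d \<subseteq> tuples q B"
      and dc: "bar_boundary A c = 0" and dd: "bar_boundary B d = 0"
      using c d by (auto simp: bar_cycles_def)
    have ky: "Poly_Mapping.keys y \<subseteq> tuples q B"
      unfolding xy by (intro keys_add_subset kd keys_bar_boundary[OF m(2) w(1)])
    have dy: "bar_boundary B y = 0"
      unfolding xy using bar_boundary_bar_boundary[OF m(2) w(1)] dd by simp
    have lin: "chain_cross A B (c + c') e = chain_cross A B c e + chain_cross A B c' e"
      "chain_cross A B c (e + e') = chain_cross A B c e + chain_cross A B c e'"
      "chain_cross A B 0 e = 0" "chain_cross A B c 0 = 0" for c c' e e'
      by (simp_all add: chain_cross_eq)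
    have "?f z - ?f (c, d) = chain_cross A B (bar_boundary A v) y + chain_cross A B c (bar_boundary B w)"
      using z(1) by (simp add: xy lin)
    also have "\<dots> = bar_boundary (A \<times>\<times> B) (chain_cross A B v y
        + frag_cmul ((- 1) ^ p) (chain_cross A B c w))"
      using chain_cross_chain_map(2)[OF A B v(1) ky] chain_cross_chain_map(2)[OF A B kc w(1)] dy dc
      by (simp add: lin flip: power_add)
    also have "\<dots> \<in> ?N"
      using chain_cross_chain_map(1)[OF A B v(1) ky] chain_cross_chain_map(1)[OF A B kc w(1)]
      by (intro bar_boundariesI keys_add_subset keys_cmul_subset) simp_all
    finally show "?f z - ?f (c, d) \<in> ?N" .
  qed
  then show ?thesis by (simp add: homology_cross_def homology_class_def[of "p + q"])
qed

lemma shuffle_cycle: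
  assumes "comm_group A" "c \<in> bar_cycles p A" "d \<in> bar_cycles q A"
  shows "shuffle c d \<in> bar_cycles (p + q) A"
  using assms bar_boundary_shuffle[OF assms(1), of c p d q] keys_shuffle[of c p A d q]
  by (auto simp: bar_cycles_def)

text \<open>The addition of \<open>A\<close> sends the letters \<open>(x, 1)\<close> and \<open>(1, y)\<close> of the cross product back to \<open>x\<close> and \<open>y\<close>.\<close>

lemma pontryagin_class:
  assumes A: "comm_group A" and c: "c \<in> bar_cycles p A" and d: "d \<in> bar_cycles q A"
  shows "pontryagin p q A (homology_class p A c) (homology_class q A d) = homology_class (p + q) A (shuffle c d)"
proof -
  interpret comm_group A by fact
  have mult: "(\<lambda>(a, b). a \<otimes>\<^bsub>A\<^esub> b) \<in> hom (A \<times>\<times> A) A"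
    by (auto simp: hom_def m_ac)
  have kc: "Poly_Mapping.keys c \<subseteq> tuples p A" and kd: "Poly_Mapping.keys d \<subseteq> tuples q A"
    and dc: "bar_boundary A c = 0" and dd: "bar_boundary A d = 0"
    using c d by (auto simp: bar_cycles_def)
  have "chain_cross A A c d \<in> bar_cycles (p + q) (A \<times>\<times> A)"
    using chain_cross_chain_map[OF A A kc kd] dc dd by (simp add: bar_cycles_def chain_cross_eq)
  moreover have "tuple_map (\<lambda>(a, b). a \<otimes>\<^bsub>A\<^esub> b) (chain_cross A A c d) = shuffle c d"
    by (simp add: chain_cross_eq tuple_map_shuffle tuple_map_tuple_map comp_def
        tuple_map_id_on[OF kc] tuple_map_id_on[OF kd])
  ultimately show ?thesis
    by (simp add: pontryagin_def homology_cross_class[OF A A c d] group_homology_map_class[OF mult])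
qed

text \<open>The last factor is an arbitrary chain: the unit \<open>[]\<close> gives the representatives of Pontryagin
  products of degree-one classes, a torsion cycle gives the classes that come from hyperplanes.\<close>

primrec shuffle_prod :: "'a list \<Rightarrow> ('a list \<Rightarrow>\<^sub>0 int) \<Rightarrow> ('a list \<Rightarrow>\<^sub>0 int)" where
  "shuffle_prod [] c = c"
| "shuffle_prod (a # as) c = shuffle (frag_of [a]) (shuffle_prod as c)"

lemma word_cycle: "a \<in> carrier A \<Longrightarrow> frag_of [a] \<in> bar_cycles 1 A"
  by (simp add: bar_cycles_def tuples_def)

lemma empty_word_cycle: "frag_of [] \<in> bar_cycles 0 A"
  by (simp add: bar_cycles_def tuples_def bar_boundary_eq)

lemma shuffle_prod_cycle:
  assumes "comm_group A" "set as \<subseteq> carrier A" "c \<in> bar_cycles q A"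
  shows "shuffle_prod as c \<in> bar_cycles (length as + q) A"
  using assms(2)
proof (induction as)
  case (Cons a as)
  then show ?case
    using shuffle_cycle[OF assms(1) word_cycle[of a A]] by fastforce
qed (use assms in simp)

lemma shuffle_prod_diff: "shuffle_prod as (c - d) = shuffle_prod as c - shuffle_prod as d"
  by (induction as) simp_all

lemma shuffle_prod_append: "shuffle_prod (as @ bs) c = shuffle_prod as (shuffle_prod bs c)"
  by (induction as) simp_all

lemma shuffle_one_boundary:
  assumes "comm_group A" "a \<in> carrier A" "c \<in> bar_boundaries n A"
  shows "shuffle (frag_of [a]) c \<in> bar_boundaries (Suc n) A"
proof -
  obtain w where w: "Poly_Mapping.keys w \<subseteq> tuples (Suc n) A" "c = bar_boundary A w"
    using assms(3) by (auto simp: bar_boundaries_eq)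
  have a: "Poly_Mapping.keys (frag_of [a]) \<subseteq> tuples 1 A"
    using assms(2) by (simp add: tuples_def)
  have "shuffle (frag_of [a]) c = bar_boundary A (- shuffle (frag_of [a]) w)"
    using bar_boundary_shuffle[OF assms(1) a w(1)] w(2) by simp
  then show ?thesis
    using keys_shuffle[OF a w(1)] bar_boundariesI[of "- shuffle (frag_of [a]) w" "Suc n" A] by simp
qed

lemma shuffle_prod_boundary:
  assumes "comm_group A" "set as \<subseteq> carrier A" "c \<in> bar_boundaries n A"
  shows "shuffle_prod as c \<in> bar_boundaries (length as + n) A"
  using assms(2) by (induction as) (use assms shuffle_one_boundary[OF assms(1)] in auto)

lemma pontryagin_prod_class:
  assumes A: "comm_group A" and "set as \<subseteq> carrier A"
  shows "pontryagin_prod A as = homology_class (length as) A (shuffle_prod as (frag_of []))"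
  using assms(2)
proof (induction as)
  case (Cons a as)
  then have "pontryagin_prod A as = homology_class (length as) A (shuffle_prod as (frag_of []))"
    by simp
  moreover have "shuffle_prod as (frag_of []) \<in> bar_cycles (length as) A"
    using shuffle_prod_cycle[OF A _ empty_word_cycle, of as] Cons by simp
  ultimately show ?case
    using pontryagin_class[OF A word_cycle[of a]] Cons
    by (simp add: H1_class_def flip: homology_class_def[of "Suc 0"])
qed (simp add: homology_class_def)

text \<open>Move the first of two equal factors to the right until it meets the second.\<close>

lemma shuffle_prod_repeated: "\<not> distinct as \<Longrightarrow> shuffle_prod as c = 0"
proof (induction as)
  case (Cons a as)
  have *: "shuffle (frag_of [a]) (shuffle_prod bs c) = 0" if "a \<in> set bs" for bs
    using that
  proof (induction bs)
    case (Cons b bs)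
    then show ?case
      using shuffle_one_square[of a] shuffle_one_anticommute[of a b] by auto
  qed simp
  then show ?case using Cons by auto
qed simp

text \<open>The chain \<open>[a|b]\<close> bounds the failure of additivity of \<open>x \<mapsto> [x]\<close>, and multiplying it by a cycle
  bounds the failure of additivity of the product.\<close>

lemma shuffle_prod_multilinear:
  assumes A: "comm_group A" and "set xs \<subseteq> carrier A" "i < length xs" "a \<in> carrier A" "b \<in> carrier A"
  shows "shuffle_prod (xs[i := a \<otimes>\<^bsub>A\<^esub> b]) (frag_of []) - shuffle_prod (xs[i := a]) (frag_of [])
     - shuffle_prod (xs[i := b]) (frag_of []) \<in> bar_boundaries (length xs) A"
  using assms(2,3)
proof (induction xs arbitrary: i)
  case (Cons x xs)
  show ?case
  proof (cases i)
    case 0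
    have c: "shuffle_prod xs (frag_of []) \<in> bar_cycles (length xs) A"
      using shuffle_prod_cycle[OF A _ empty_word_cycle, of xs] Cons by simp
    have ab: "Poly_Mapping.keys (frag_of [a, b]) \<subseteq> tuples 2 A"
      using assms(4,5) by (simp add: tuples_def)
    have d: "bar_boundary A (frag_of [a, b]) = frag_of [b] - frag_of [a \<otimes>\<^bsub>A\<^esub> b] + frag_of [a]"
      by (simp add: bar_boundary_eq)
    have "bar_boundary A (- shuffle (frag_of [a, b]) (shuffle_prod xs (frag_of [])))
        = shuffle_prod ((x # xs)[i := a \<otimes>\<^bsub>A\<^esub> b]) (frag_of []) - shuffle_prod ((x # xs)[i := a]) (frag_of [])
          - shuffle_prod ((x # xs)[i := b]) (frag_of [])"
      using c bar_boundary_shuffle[OF A ab, of "shuffle_prod xs (frag_of [])" "length xs"] 0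
      by (simp add: bar_cycles_def d algebra_simps)
    moreover have "Poly_Mapping.keys (- shuffle (frag_of [a, b]) (shuffle_prod xs (frag_of []))) \<subseteq> tuples (Suc (length (x # xs))) A"
      using keys_shuffle[OF ab, of "shuffle_prod xs (frag_of [])" "length xs"] c
      by (simp add: bar_cycles_def)
    ultimately show ?thesis
      using bar_boundariesI by metis
  next
    case (Suc j)
    have "shuffle (frag_of [x]) (shuffle_prod (xs[j := a \<otimes>\<^bsub>A\<^esub> b]) (frag_of []) - shuffle_prod (xs[j := a]) (frag_of [])
     - shuffle_prod (xs[j := b]) (frag_of [])) \<in> bar_boundaries (Suc (length xs)) A"
      by (rule shuffle_one_boundary[OF A]) (use Suc Cons in auto)
    then show ?thesis using Suc by simp
  qed
qed simp

section \<open>The homomorphism from the exterior power to homology\<close>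

lemma exterior_relatorsE [consumes 1, case_names additive repeated]:
  assumes "r \<in> exterior_relators n A"
  obtains (additive) xs i a b
      where "r = frag_of (xs[i := a \<otimes>\<^bsub>A\<^esub> b]) - frag_of (xs[i := a]) - frag_of (xs[i := b])"
        "xs \<in> tuples n A" "i < n" "a \<in> carrier A" "b \<in> carrier A"
    | (repeated) xs i j
      where "r = frag_of xs" "xs \<in> tuples n A" "i < j" "j < n" "xs ! i = xs ! j"
  using assms unfolding exterior_relators_def by blast

lemma exterior_relators_keys:
  assumes "monoid A" "r \<in> exterior_relators n A"
  shows "Poly_Mapping.keys r \<subseteq> tuples n A"
proof -
  have upd: "xs[i := a] \<in> tuples n A" if "xs \<in> tuples n A" "a \<in> carrier A" for xs i a
    using that set_update_subset_insert[of xs i a] by (auto simp: tuples_def)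
  from assms(2) show ?thesis
  proof (cases rule: exterior_relatorsE)
    case additive
    then show ?thesis
      using upd monoid.m_closed[OF assms(1)] by (simp add: keys_diff_subset)
  qed simp
qed

lemma exterior_relations_subgroup:
  "monoid A \<Longrightarrow> subgroup (exterior_relations n A) (free_Abelian_group (tuples n A))"
  unfolding exterior_relations_def
  by (rule group.generate_is_subgroup) (simp, rule subsetI, simp add: exterior_relators_keys)

lemma diff_closed_exterior_relations:
  assumes "monoid A"
  shows "diff_closed (exterior_relations n A)"
  unfolding diff_closed_def
proof (intro conjI ballI)
  interpret subgroup "exterior_relations n A" "free_Abelian_group (tuples n A)"
    using assms by (rule exterior_relations_subgroup)
  show "0 \<in> exterior_relations n A" using one_closed by simp
  fix x y assume x: "x \<in> exterior_relations n A" and y: "y \<in> exterior_relations n A"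
  show "x - y \<in> exterior_relations n A"
  proof -
    have "- y \<in> exterior_relations n A"
      using m_inv_closed[OF y] mem_carrier[OF y] by simp
    then show ?thesis
      using m_closed[OF x, of "- y"] by simp
  qed
qed

text \<open>Since the relators lie in an additive group, closure under differences covers all the
  operations by which they generate the relations.\<close>

lemma exterior_relations_induct [consumes 2, case_names relator zero diff]:
  assumes "r \<in> exterior_relations n A" "monoid A"
    and "\<And>r. r \<in> exterior_relators n A \<Longrightarrow> P r" "P 0" "\<And>x y. P x \<Longrightarrow> P y \<Longrightarrow> P (x - y)"
  shows "P r"
proof -
  have neg: "P (- x)" if "P x" for x
    using assms(5)[OF assms(4) that] by simp
  have add: "P (x + y)" if "P x" "P y" for x y
    using assms(5)[OF that(1) neg[OF that(2)]] by simp
  from assms(1) show ?thesis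
    unfolding exterior_relations_def
  proof (induction rule: generate.induct)
    case (inv h)
    then show ?case
      using exterior_relators_keys[OF assms(2)] assms(3) neg by simp
  qed (use assms add in auto)
qed

text \<open>The linear extension of the iterated shuffle product maps every relator to a boundary, so that it
  takes a single class as value on each coset of the relations.\<close>

lemma exterior_to_homology_class:
  assumes A: "comm_group A" and "Poly_Mapping.keys c \<subseteq> tuples n A"
  shows "exterior_to_homology n A (exterior_relations n A #>\<^bsub>free_Abelian_group (tuples n A)\<^esub> c)
     = homology_class n A (frag_extend (\<lambda>xs. shuffle_prod xs (frag_of [])) c)"
proof -
  let ?S = "\<lambda>xs. shuffle_prod xs (frag_of [])"
  let ?R = "exterior_relations n A" and ?F = "free_Abelian_group (tuples n A)"
  have m: "monoid A"
    using A by (simp add: comm_group.axioms comm_monoid.axioms)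
  have cyc: "?S xs \<in> bar_cycles n A" if "xs \<in> tuples n A" for xs
    using that shuffle_prod_cycle[OF A _ empty_word_cycle, of xs] by (simp add: tuples_def)
  have eval: "finprod (group_homology n A)
       (\<lambda>xs. pontryagin_prod A xs [^]\<^bsub>group_homology n A\<^esub> Poly_Mapping.lookup x xs) (Poly_Mapping.keys x)
      = homology_class n A (frag_extend ?S x)" if x: "Poly_Mapping.keys x \<subseteq> tuples n A" for x
  proof -
    interpret H: comm_group "group_homology n A"
      using m by (rule comm_group_homology)
    let ?g = "\<lambda>xs. frag_cmul (Poly_Mapping.lookup x xs) (?S xs)"
    have g: "?g xs \<in> bar_cycles n A" if "xs \<in> Poly_Mapping.keys x" for xs
      using cyc bar_cycles_cmul subsetD[OF x that] by blast
    have "finprod (group_homology n A)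
       (\<lambda>xs. pontryagin_prod A xs [^]\<^bsub>group_homology n A\<^esub> Poly_Mapping.lookup x xs) (Poly_Mapping.keys x)
      = finprod (group_homology n A) (\<lambda>xs. homology_class n A (?g xs)) (Poly_Mapping.keys x)"
    proof (rule H.finprod_cong')
      show "(\<lambda>xs. homology_class n A (?g xs)) \<in> Poly_Mapping.keys x \<rightarrow> carrier (group_homology n A)"
        using g by (auto simp: carrier_group_homology)
      fix xs assume "xs \<in> Poly_Mapping.keys x"
      then have xs: "xs \<in> tuples n A" using x by blast
      then have "pontryagin_prod A xs = homology_class n A (?S xs)"
        using pontryagin_prod_class[OF A, of xs] by (simp add: tuples_def)
      then show "pontryagin_prod A xs [^]\<^bsub>group_homology n A\<^esub> Poly_Mapping.lookup x xs = homology_class n A (?g xs)"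
        using homology_class_int_pow[OF m cyc[OF xs]] by simp
    qed simp
    also have "\<dots> = homology_class n A (frag_extend ?S x)"
      unfolding frag_extend_def by (rule finprod_homology_class[OF m finite_keys g])
    finally show ?thesis .
  qed
  have rel: "frag_extend ?S r \<in> bar_boundaries n A" if "r \<in> ?R" for r
    using that m
  proof (induction rule: exterior_relations_induct)
    case (relator r)
    then show ?case
    proof (cases rule: exterior_relatorsE)
      case (additive xs i a b)
      then show ?thesis
        using shuffle_prod_multilinear[OF A, of xs i a b] by (simp add: frag_extend_linear tuples_def)
    next
      case (repeated xs i j)
      then have "i < length xs" "j < length xs" "i \<noteq> j" by (simp_all add: tuples_def)
      with repeated(5) have "\<not> distinct xs" unfolding distinct_conv_nth by blast
      then show ?thesis
        using repeated shuffle_prod_repeated[of xs] diff_closedD(1)[OF diff_closed_bar_boundaries] by simp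
    qed
  qed (use diff_closedD[OF diff_closed_bar_boundaries] in \<open>auto simp: frag_extend_linear\<close>)
  have "(\<lambda>c. finprod (group_homology n A)
       (\<lambda>xs. pontryagin_prod A xs [^]\<^bsub>group_homology n A\<^esub> Poly_Mapping.lookup c xs)
       (Poly_Mapping.keys c)) ` (?R #>\<^bsub>?F\<^esub> c) = {homology_class n A (frag_extend ?S c)}"
  proof -
    have "finprod (group_homology n A)
       (\<lambda>xs. pontryagin_prod A xs [^]\<^bsub>group_homology n A\<^esub> Poly_Mapping.lookup (r + c) xs) (Poly_Mapping.keys (r + c))
       = homology_class n A (frag_extend ?S c)" if "r \<in> ?R" for r
    proof -
      have "Poly_Mapping.keys r \<subseteq> tuples n A"
        using subgroup.subset[OF exterior_relations_subgroup[OF m]] that by fastforce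
      then show ?thesis
        using eval[OF keys_add_subset[OF _ assms(2)]] rel[OF that]
        by (simp add: frag_extend_linear homology_class_eqI)
    qed
    then show ?thesis
      using diff_closedD(1)[OF diff_closed_exterior_relations[OF m, of n]]
      unfolding r_coset_additive[OF mult_free_Abelian_group_eq] by (auto simp: image_iff intro!: exI[of _ 0])
  qed
  then show ?thesis by (simp add: exterior_to_homology_def)
qed

section \<open>The determinant over the field with two elements\<close>

text \<open>In characteristic two the determinant is the permanent. The entries \<open>x\<close> of the list stand for
  vectors of dimension \<open>n\<close> given by their supports \<open>g x\<close>. The sum vanishes for
  repeated rows and for equal columns because of a fixed-point free involution of the set of
  permutations that preserves the summands.\<close>

definition det_mod2 :: "nat \<Rightarrow> ('a \<Rightarrow> nat set) \<Rightarrow> 'a list \<Rightarrow> bit" where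
  "det_mod2 n g xs = (\<Sum>\<sigma> | \<sigma> permutes {..<n}. \<Prod>i<n. of_bool (\<sigma> i \<in> g (xs ! i)))"

lemma bit_add_self [simp]: "x + x = (0::bit)"
  by (cases x) auto

lemma det_mod2_add:
  assumes "i < n" "length xs = n" "g c = (g a - g b) \<union> (g b - g a)"
  shows "det_mod2 n g (xs[i := c]) = det_mod2 n g (xs[i := a]) + det_mod2 n g (xs[i := b])"
proof -
  have split: "(\<Prod>j<n. of_bool (\<sigma> j \<in> g (xs[i := x] ! j)) :: bit)
      = of_bool (\<sigma> i \<in> g x) * (\<Prod>j\<in>{..<n} - {i}. of_bool (\<sigma> j \<in> g (xs ! j)))" for \<sigma> x
  proof -
    have "(\<Prod>j\<in>{..<n} - {i}. of_bool (\<sigma> j \<in> g (xs[i := x] ! j)) :: bit)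
        = (\<Prod>j\<in>{..<n} - {i}. of_bool (\<sigma> j \<in> g (xs ! j)))"
      by (rule prod.cong) auto
    then show ?thesis
      using assms(1,2) by (simp add: prod.remove[of "{..<n}" i])
  qed
  have "(of_bool (\<sigma> i \<in> g c) :: bit) = of_bool (\<sigma> i \<in> g a) + of_bool (\<sigma> i \<in> g b)" for \<sigma>
    using assms(3) by auto
  then show ?thesis
    by (simp only: det_mod2_def split distrib_right sum.distrib)
qed

lemma det_mod2_repeated:
  assumes "i < n" "j < n" "i \<noteq> j" "xs ! i = xs ! j"
  shows "det_mod2 n g xs = 0"
  unfolding det_mod2_def
proof (rule sum_involution_eq_0[where h = "\<lambda>\<sigma>. \<sigma> \<circ> transpose i j"])
  have t: "transpose i j permutes {..<n}"
    using assms by (simp add: permutes_swap_id)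
  fix \<sigma> assume "\<sigma> \<in> {\<sigma>. \<sigma> permutes {..<n}}"
  then have \<sigma>: "\<sigma> permutes {..<n}" by simp
  have "xs ! transpose i j k = xs ! k" for k
    using assms(4) by (simp add: transpose_def)
  then have "(\<Prod>k<n. of_bool ((\<sigma> \<circ> transpose i j) k \<in> g (xs ! k)) :: bit)
      = (\<Prod>k<n. of_bool (\<sigma> k \<in> g (xs ! k)))"
    using prod.permute[OF t, of "\<lambda>k. of_bool (\<sigma> k \<in> g (xs ! k)) :: bit"] by (simp add: comp_def)
  then show "(\<Prod>k<n. of_bool ((\<sigma> \<circ> transpose i j) k \<in> g (xs ! k)) :: bit)
      + (\<Prod>k<n. of_bool (\<sigma> k \<in> g (xs ! k))) = 0"
    by simp
  show "\<sigma> \<circ> transpose i j \<in> {\<sigma>. \<sigma> permutes {..<n}}"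
    using permutes_compose[OF t \<sigma>] by simp
  show "\<sigma> \<circ> transpose i j \<circ> transpose i j = \<sigma>"
    by (simp add: comp_assoc)
  show "\<sigma> \<circ> transpose i j \<noteq> \<sigma>"
  proof
    assume "\<sigma> \<circ> transpose i j = \<sigma>"
    then have "\<sigma> j = \<sigma> i" by (metis comp_apply transpose_apply_first)
    then show False
      using permutes_inj[OF \<sigma>] assms(3) by (auto dest: injD)
  qed
qed

text \<open>Two equal columns: exchange the values \<open>k\<close> and \<open>l\<close> of each permutation.\<close>

lemma det_mod2_equal_coordinates:
  assumes "k < n" "l < n" "k \<noteq> l" "\<And>i. i < n \<Longrightarrow> k \<in> g (xs ! i) \<longleftrightarrow> l \<in> g (xs ! i)"
  shows "det_mod2 n g xs = 0"
  unfolding det_mod2_def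
proof (rule sum_involution_eq_0[where h = "\<lambda>\<sigma>. transpose k l \<circ> \<sigma>"])
  have t: "transpose k l permutes {..<n}"
    using assms by (simp add: permutes_swap_id)
  fix \<sigma> assume "\<sigma> \<in> {\<sigma>. \<sigma> permutes {..<n}}"
  then have \<sigma>: "\<sigma> permutes {..<n}" by simp
  have "(\<Prod>i<n. of_bool ((transpose k l \<circ> \<sigma>) i \<in> g (xs ! i)) :: bit)
      = (\<Prod>i<n. of_bool (\<sigma> i \<in> g (xs ! i)))"
    using assms(4) by (intro prod.cong) (auto simp: transpose_def)
  then show "(\<Prod>i<n. of_bool ((transpose k l \<circ> \<sigma>) i \<in> g (xs ! i)) :: bit)
      + (\<Prod>i<n. of_bool (\<sigma> i \<in> g (xs ! i))) = 0"
    by simp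
  show "transpose k l \<circ> \<sigma> \<in> {\<sigma>. \<sigma> permutes {..<n}}"
    using permutes_compose[OF \<sigma> t] by simp
  show "transpose k l \<circ> (transpose k l \<circ> \<sigma>) = \<sigma>"
    by (simp flip: comp_assoc)
  show "transpose k l \<circ> \<sigma> \<noteq> \<sigma>"
  proof
    assume *: "transpose k l \<circ> \<sigma> = \<sigma>"
    obtain i where "\<sigma> i = k"
      using permutes_surj[OF \<sigma>] by (metis surj_def)
    with fun_cong[OF *, of i] assms(3) show False by simp
  qed
qed

lemma det_mod2_zero_coordinate:
  assumes "k < n" "\<And>i. i < n \<Longrightarrow> k \<notin> g (xs ! i)"
  shows "det_mod2 n g xs = 0"
  unfolding det_mod2_def
proof (rule sum.neutral, rule ballI)
  fix \<sigma> assume "\<sigma> \<in> {\<sigma>. \<sigma> permutes {..<n}}"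
  then have "k \<in> \<sigma> ` {..<n}"
    using assms(1) by (simp add: permutes_image)
  then obtain i where "i < n" "k = \<sigma> i" by auto
  then show "(\<Prod>i<n. of_bool (\<sigma> i \<in> g (xs ! i)) :: bit) = 0"
    using assms(2) by (intro prod_zero) auto
qed

lemma det_mod2_identity:
  assumes "\<And>i. i < n \<Longrightarrow> g (xs ! i) = {i}"
  shows "det_mod2 n g xs = 1"
proof -
  have "(\<Prod>i<n. of_bool (\<sigma> i \<in> g (xs ! i)) :: bit) = of_bool (\<sigma> = id)" if \<sigma>: "\<sigma> permutes {..<n}" for \<sigma>
  proof (cases "\<sigma> = id")
    case True
    then show ?thesis by (simp add: assms)
  next
    case False
    then obtain i where "\<sigma> i \<noteq> i" by fastforce
    moreover from this have "i < n"
      using permutes_not_in[OF \<sigma>] by (meson lessThan_iff)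
    ultimately show ?thesis
      using False by (auto simp: assms intro!: prod_zero)
  qed
  then have "det_mod2 n g xs = (\<Sum>\<sigma> | \<sigma> permutes {..<n}. of_bool (\<sigma> = id))"
    unfolding det_mod2_def by (intro sum.cong) auto
  also have "\<dots> = (\<Sum>\<sigma>\<in>{id :: nat \<Rightarrow> nat}. of_bool (\<sigma> = id))"
    by (rule sum.mono_neutral_right) (auto simp: finite_permutations permutes_id)
  finally show ?thesis by simp
qed

definition det_chain :: "nat \<Rightarrow> ('a \<Rightarrow> nat set) \<Rightarrow> ('a list \<Rightarrow>\<^sub>0 int) \<Rightarrow> bit" where
  "det_chain n g v = (\<Sum>xs\<in>Poly_Mapping.keys v. of_int (Poly_Mapping.lookup v xs) * det_mod2 n g xs)"

lemma det_chain_superset: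
  "finite S \<Longrightarrow> Poly_Mapping.keys v \<subseteq> S \<Longrightarrow>
     det_chain n g v = (\<Sum>xs\<in>S. of_int (Poly_Mapping.lookup v xs) * det_mod2 n g xs)"
  unfolding det_chain_def by (rule sum.mono_neutral_left) (auto simp: not_in_keys_iff_lookup_eq_zero)

lemma det_chain_simps [simp]:
  "det_chain n g 0 = 0" "det_chain n g (frag_of xs) = det_mod2 n g xs"
  "det_chain n g (v - w) = det_chain n g v - det_chain n g w"
  "det_chain n g (v + w) = det_chain n g v + det_chain n g w"
proof -
  let ?S = "Poly_Mapping.keys v \<union> Poly_Mapping.keys w"
  have S: "finite ?S" by simp
  note expand = det_chain_superset[OF S Un_upper1, of n g] det_chain_superset[OF S Un_upper2, of n g]
  show "det_chain n g (v - w) = det_chain n g v - det_chain n g w"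
    by (simp only: expand det_chain_superset[OF S keys_diff] lookup_minus of_int_diff left_diff_distrib sum_subtractf)
  show "det_chain n g (v + w) = det_chain n g v + det_chain n g w"
    by (simp only: expand det_chain_superset[OF S Poly_Mapping.keys_add] lookup_add of_int_add distrib_right sum.distrib)
  show "det_chain n g (frag_of xs) = det_mod2 n g xs"
    unfolding det_chain_def keys_frag_of lookup_frag_of by (subst sum.insert) simp_all
qed (simp add: det_chain_def)

lemma det_chain_eq_0:
  "(\<And>xs. xs \<in> Poly_Mapping.keys v \<Longrightarrow> det_mod2 n g xs = 0) \<Longrightarrow> det_chain n g v = 0"
  by (simp add: det_chain_def)

lemma det_chain_exterior_relations:
  assumes "monoid A" "r \<in> exterior_relations n A"
    and "\<And>x y. x \<in> carrier A \<Longrightarrow> y \<in> carrier A \<Longrightarrow> g (x \<otimes>\<^bsub>A\<^esub> y) = (g x - g y) \<union> (g y - g x)"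
  shows "det_chain n g r = 0"
  using assms(2,1)
proof (induction rule: exterior_relations_induct)
  case (relator r)
  then show ?case
  proof (cases rule: exterior_relatorsE)
    case (additive xs i a b)
    then have "det_mod2 n g (xs[i := a \<otimes>\<^bsub>A\<^esub> b]) = det_mod2 n g (xs[i := a]) + det_mod2 n g (xs[i := b])"
      by (intro det_mod2_add assms(3)) (simp_all add: tuples_def)
    with additive(1) show ?thesis
      by (simp only: det_chain_simps add_diff_cancel_left' diff_self)
  next
    case (repeated xs i j)
    then show ?thesis by (simp add: det_mod2_repeated[of i n j])
  qed
qed simp_all

section \<open>Natural transformations and classes from subgroups\<close>

lemma exterior_relations_mono:
  assumes "monoid A" "subgroup K A" "monoid (A\<lparr>carrier := K\<rparr>)"
  shows "exterior_relations n (A\<lparr>carrier := K\<rparr>) \<subseteq> exterior_relations n A"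
proof
  have tuples: "tuples n (A\<lparr>carrier := K\<rparr>) \<subseteq> tuples n A"
    using subgroup.subset[OF assms(2)] by (auto simp: tuples_def)
  have relators: "r \<in> exterior_relators n A" if "r \<in> exterior_relators n (A\<lparr>carrier := K\<rparr>)" for r
    using that
  proof (cases rule: exterior_relatorsE)
    case (additive xs i a b)
    then have "xs \<in> tuples n A" "a \<in> carrier A" "b \<in> carrier A"
      using tuples subgroup.subset[OF assms(2)] by auto
    with additive(1,3) show ?thesis
      unfolding exterior_relators_def by auto
  next
    case (repeated xs i j)
    with tuples show ?thesis
      unfolding exterior_relators_def by blast
  qed
  fix r assume "r \<in> exterior_relations n (A\<lparr>carrier := K\<rparr>)"
  then show "r \<in> exterior_relations n A"
    using assms(3)
  proof (induction rule: exterior_relations_induct)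
    case (relator r)
    then show ?case
      unfolding exterior_relations_def using relators by (intro generate.incl) auto
  qed (use diff_closedD[OF diff_closed_exterior_relations[OF assms(1)]] in auto)
qed

text \<open>The class of \<open>c\<close> in \<open>A\<close> is the image of its class in \<open>K\<close>. By naturality its value under \<open>\<tau>\<close> comes
  from the exterior power of \<open>K\<close>, so it is represented by a combination of \<open>n\<close>-tuples in \<open>K\<close>.\<close>

lemma natural_transformation_vanishes_on_subgroup:
  fixes \<tau> :: "'a monoid \<Rightarrow> ('a list \<Rightarrow>\<^sub>0 int) set \<Rightarrow> ('a list \<Rightarrow>\<^sub>0 int) set"
  assumes nat: "natural_transformation
             (group_homology n) (group_homology_map n)
             (exterior_power n) (exterior_power_map n) \<tau>"
    and A: "fg_abelian_group A" and K: "subgroup K A" and B: "fg_abelian_group (A\<lparr>carrier := K\<rparr>)"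
    and g: "\<And>x y. x \<in> carrier A \<Longrightarrow> y \<in> carrier A \<Longrightarrow> g (x \<otimes>\<^bsub>A\<^esub> y) = (g x - g y) \<union> (g y - g x)"
    and det: "\<And>xs. length xs = n \<Longrightarrow> set xs \<subseteq> K \<Longrightarrow> det_mod2 n g xs = 0"
    and c: "c \<in> bar_cycles n (A\<lparr>carrier := K\<rparr>)" and v: "v \<in> \<tau> A (homology_class n A c)"
  shows "det_chain n g v = 0"
proof -
  let ?B = "A\<lparr>carrier := K\<rparr>"
  have m: "monoid A" "monoid ?B"
    using A B by (simp_all add: fg_abelian_group_def comm_group.axioms comm_monoid.axioms)
  have id: "id \<in> hom ?B A"
    using subgroup.subset[OF K] by (auto simp: hom_def)
  have tid: "tuple_map id u = u" for u :: "'a list \<Rightarrow>\<^sub>0 int"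
    by (induction u rule: chain_induct) auto
  have cB: "homology_class n ?B c \<in> carrier (group_homology n ?B)"
    using c by (simp add: carrier_group_homology)
  have "\<tau> A (homology_class n A c) = \<tau> A (group_homology_map n ?B A id (homology_class n ?B c))"
    by (simp add: group_homology_map_class[OF id c] tid)
  also have "\<dots> = exterior_power_map n ?B A id (\<tau> ?B (homology_class n ?B c))"
    using nat A B id cB unfolding natural_transformation_def by blast
  finally have eq: "\<tau> A (homology_class n A c) = exterior_power_map n ?B A id (\<tau> ?B (homology_class n ?B c))" .
  have "\<tau> ?B (homology_class n ?B c) \<in> carrier (exterior_power n ?B)"
    using nat B cB unfolding natural_transformation_def hom_def by blast
  then obtain u where u: "Poly_Mapping.keys u \<subseteq> tuples n ?B"
    "\<tau> ?B (homology_class n ?B c) = exterior_relations n ?B #>\<^bsub>free_Abelian_group (tuples n ?B)\<^esub> u"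
    by (auto simp: exterior_power_def carrier_FactGroup)
  have "exterior_power_map n ?B A id (\<tau> ?B (homology_class n ?B c))
      = exterior_relations n A #>\<^bsub>free_Abelian_group (tuples n A)\<^esub> tuple_map id u"
    unfolding exterior_power_map_def
  proof (rule coset_map_eq[OF mult_free_Abelian_group_eq diff_closed_exterior_relations[OF m(1)]])
    show "u \<in> \<tau> ?B (homology_class n ?B c)"
      unfolding u(2) r_coset_additive[OF mult_free_Abelian_group_eq]
      using diff_closedD(1)[OF diff_closed_exterior_relations[OF m(2)]] by (intro image_eqI[of _ _ 0]) auto
    fix x assume "x \<in> \<tau> ?B (homology_class n ?B c)"
    then show "tuple_map id x - tuple_map id u \<in> exterior_relations n A"
      unfolding u(2) r_coset_additive[OF mult_free_Abelian_group_eq] tid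
      using exterior_relations_mono[OF m(1) K m(2), of n] by auto
  qed
  then obtain r where "r \<in> exterior_relations n A" "v = r + u"
    using v eq unfolding r_coset_additive[OF mult_free_Abelian_group_eq] tid by auto
  moreover have "det_chain n g u = 0"
    using u(1) by (intro det_chain_eq_0 det) (auto simp: tuples_def)
  ultimately show ?thesis
    using det_chain_exterior_relations[OF m(1) _ g] by simp
qed

section \<open>Elementary abelian groups of exponent two\<close>

definition decode :: "nat \<Rightarrow> (nat set \<Rightarrow> 'a) \<Rightarrow> 'a \<Rightarrow> nat set" where
  "decode n e = inv_into (Pow {..<n}) e"

text \<open>The vector space of dimension \<open>n\<close> over the field with two elements, as the power set of
  \<open>{..<n}\<close> under symmetric difference. It is transported along an injection \<open>e\<close> because the groups
  under consideration are carried by subsets of a given infinite type.\<close>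

definition symdiff_group :: "nat \<Rightarrow> (nat set \<Rightarrow> 'a) \<Rightarrow> 'a monoid" where
  "symdiff_group n e =
     \<lparr>carrier = e ` Pow {..<n},
      monoid.mult = \<lambda>x y. e ((decode n e x - decode n e y) \<union> (decode n e y - decode n e x)),
      one = e {}\<rparr>"

lemma finite_imp_fg_abelian_group:
  assumes "comm_group A" "finite (carrier A)"
  shows "fg_abelian_group A"
proof -
  have "generate A (carrier A) = carrier A"
    using group.generate_incl[OF comm_group.axioms(2)[OF assms(1)], of "carrier A"] generate.incl[of _ "carrier A" A]
    by auto
  with assms show ?thesis unfolding fg_abelian_group_def by blast
qed

context
  fixes n :: nat and e :: "nat set \<Rightarrow> 'a"
  assumes inj: "inj_on e (Pow {..<n})"
begin

lemma decode_encode: "S \<subseteq> {..<n} \<Longrightarrow> decode n e (e S) = S"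
  using inj by (simp add: decode_def)

lemma decode_mult:
  assumes "x \<in> carrier (symdiff_group n e)" "y \<in> carrier (symdiff_group n e)"
  shows "decode n e (x \<otimes>\<^bsub>symdiff_group n e\<^esub> y) = (decode n e x - decode n e y) \<union> (decode n e y - decode n e x)"
proof -
  have "(decode n e x - decode n e y) \<union> (decode n e y - decode n e x) \<subseteq> {..<n}"
    using assms decode_encode by (auto simp: symdiff_group_def)
  then show ?thesis by (simp add: symdiff_group_def decode_encode)
qed

lemma symdiff_square:
  "x \<otimes>\<^bsub>symdiff_group n e\<^esub> x = \<one>\<^bsub>symdiff_group n e\<^esub>"
  by (simp add: symdiff_group_def)

lemma comm_group_symdiff: "comm_group (symdiff_group n e)" (is "comm_group ?A")
proof (rule comm_groupI)
  have carr: "x \<in> carrier ?A \<longleftrightarrow> decode n e x \<subseteq> {..<n} \<and> x = e (decode n e x)" for x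
    using decode_encode by (auto simp: symdiff_group_def)
  have eqI: "x = y" if "x \<in> carrier ?A" "y \<in> carrier ?A" "decode n e x = decode n e y" for x y
    using that carr by metis
  show closed: "x \<otimes>\<^bsub>?A\<^esub> y \<in> carrier ?A" if "x \<in> carrier ?A" "y \<in> carrier ?A" for x y
    using that by (auto simp: symdiff_group_def decode_encode)
  show one: "\<one>\<^bsub>?A\<^esub> \<in> carrier ?A" by (simp add: symdiff_group_def)
  show "x \<otimes>\<^bsub>?A\<^esub> y \<otimes>\<^bsub>?A\<^esub> z = x \<otimes>\<^bsub>?A\<^esub> (y \<otimes>\<^bsub>?A\<^esub> z)"
    if "x \<in> carrier ?A" "y \<in> carrier ?A" "z \<in> carrier ?A" for x y z
    using that by (intro eqI closed) (auto simp: closed decode_mult)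
  show "x \<otimes>\<^bsub>?A\<^esub> y = y \<otimes>\<^bsub>?A\<^esub> x" for x y
    by (simp add: symdiff_group_def Un_commute)
  have "decode n e \<one>\<^bsub>?A\<^esub> = {}" by (simp add: symdiff_group_def decode_encode)
  then show "\<one>\<^bsub>?A\<^esub> \<otimes>\<^bsub>?A\<^esub> x = x" if "x \<in> carrier ?A" for x
    using that one by (intro eqI closed) (auto simp: decode_mult)
  show "\<exists>y\<in>carrier ?A. y \<otimes>\<^bsub>?A\<^esub> x = \<one>\<^bsub>?A\<^esub>" if "x \<in> carrier ?A" for x
    using that symdiff_square by blast
qed

lemma symdiff_subgroup:
  assumes "\<one>\<^bsub>symdiff_group n e\<^esub> \<in> K" "K \<subseteq> carrier (symdiff_group n e)"
    and "\<And>x y. x \<in> K \<Longrightarrow> y \<in> K \<Longrightarrow> x \<otimes>\<^bsub>symdiff_group n e\<^esub> y \<in> K"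
  shows "subgroup K (symdiff_group n e)"
proof
  interpret comm_group "symdiff_group n e" by (rule comm_group_symdiff)
  show "inv\<^bsub>symdiff_group n e\<^esub> x \<in> K" if "x \<in> K" for x
    using that assms(2) inv_equality[OF symdiff_square, of x] by auto
qed (use assms in auto)

end

section \<open>The monomorphism does not split naturally\<close>

theorem proposition3p1:
  fixes n :: nat
  assumes "infinite (UNIV :: 'a set)" and "n \<ge> 3"
  shows "\<not> (\<exists>\<tau> :: 'a monoid \<Rightarrow> ('a list \<Rightarrow>\<^sub>0 int) set \<Rightarrow> ('a list \<Rightarrow>\<^sub>0 int) set.
           natural_transformation
             (group_homology n) (group_homology_map n)
             (exterior_power n) (exterior_power_map n) \<tau> \<and>
           (\<forall>A. fg_abelian_group A \<longrightarrow>
              (\<forall>x\<in>carrier (exterior_power n A). \<tau> A (exterior_to_homology n A x) = x)))"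
proof
  assume "\<exists>\<tau> :: 'a monoid \<Rightarrow> ('a list \<Rightarrow>\<^sub>0 int) set \<Rightarrow> ('a list \<Rightarrow>\<^sub>0 int) set.
           natural_transformation
             (group_homology n) (group_homology_map n)
             (exterior_power n) (exterior_power_map n) \<tau> \<and>
           (\<forall>A. fg_abelian_group A \<longrightarrow>
              (\<forall>x\<in>carrier (exterior_power n A). \<tau> A (exterior_to_homology n A x) = x))"
  then obtain \<tau> :: "'a monoid \<Rightarrow> ('a list \<Rightarrow>\<^sub>0 int) set \<Rightarrow> ('a list \<Rightarrow>\<^sub>0 int) set"
    where nat: "natural_transformation (group_homology n) (group_homology_map n)
             (exterior_power n) (exterior_power_map n) \<tau>"
      and retract: "\<And>A x. fg_abelian_group A \<Longrightarrow> x \<in> carrier (exterior_power n A) \<Longrightarrow>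
             \<tau> A (exterior_to_homology n A x) = x"
    by blast
  \<comment> \<open>The type has room for a set of \<open>2\<^sup>n\<close> elements, and hence for the group.\<close>
  obtain V :: "'a set" where V: "finite V" "card V = 2 ^ n"
    using infinite_arbitrarily_large[OF assms(1)] by blast
  obtain enc where "bij_betw enc (Pow {..<n}) V"
    using finite_same_card_bij[of "Pow {..<n}" V] V by (auto simp: card_Pow)
  then have inj: "inj_on enc (Pow {..<n})" by (simp add: bij_betw_def)
  define g where "g = decode n enc"
  have g_e: "g (enc S) = S" if "S \<subseteq> {..<n}" for S
    using that inj by (simp add: g_def decode_encode)
  define A where "A = symdiff_group n enc"
  have A: "comm_group A"
    unfolding A_def using inj by (rule comm_group_symdiff)
  interpret A: comm_group A by fact
  have carr: "carrier A = enc ` Pow {..<n}" by (simp add: A_def symdiff_group_def)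
  have g_mult: "g (x \<otimes>\<^bsub>A\<^esub> y) = (g x - g y) \<union> (g y - g x)" if "x \<in> carrier A" "y \<in> carrier A" for x y
    using that unfolding A_def g_def by (rule decode_mult[OF inj])
  have g_one: "g \<one>\<^bsub>A\<^esub> = {}" by (simp add: A_def symdiff_group_def g_e)
  have sq: "x \<otimes>\<^bsub>A\<^esub> x = \<one>\<^bsub>A\<^esub>" for x
    by (simp add: A_def symdiff_group_def)
  have fgA: "fg_abelian_group A"
    using A by (rule finite_imp_fg_abelian_group) (simp add: carr)
  obtain m where n: "n = m + 3" using assms(2) by (metis le_Suc_ex add.commute)
  define a b c where "a = enc {m}" and "b = enc {m + 1}" and "c = enc {m + 2}"
  have abc: "a \<in> carrier A" "b \<in> carrier A" "c \<in> carrier A"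
    by (auto simp: carr a_def b_def c_def n)
  have g_abc: "g a = {m}" "g b = {m + 1}" "g c = {m + 2}"
    by (simp_all add: g_e a_def b_def c_def n)
  define pre where "pre = map (\<lambda>i. enc {i}) [0..<m]"
  define es where "es = pre @ [a, b, c]"
  have pre: "set pre \<subseteq> carrier A" "length pre = m"
    by (auto simp: carr pre_def n)
  have es: "set es \<subseteq> carrier A" "length es = n"
    using pre abc by (auto simp: es_def n)
  have g_es: "g (es ! i) = {i}" if "i < n" for i
  proof -
    have "[0..<n] = [0..<m] @ [m, m + 1, m + 2]"
      by (simp add: n numeral_3_eq_3)
    then have "es = map (\<lambda>i. enc {i}) [0..<n]"
      by (simp add: es_def pre_def a_def b_def c_def)
    then show ?thesis using that by (simp add: g_e)
  qed
  let ?I = "shuffle_prod pre"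
  \<comment> \<open>The predicate \<open>\<Phi>\<close> is the linear equation of a hyperplane, as a condition on supports. It holds for
    the basis vectors that precede \<open>a\<close> and for the two entries of the torsion cycle.\<close>
  have vanishes: "det_chain n g v = 0"
    if x: "x \<in> carrier A" and y: "y \<in> carrier A" and v: "v \<in> \<tau> A (homology_class n A (?I (torsion_cycle A x y)))"
      and \<Phi>: "\<Phi> {}" "\<And>S T. \<Phi> S \<Longrightarrow> \<Phi> T \<Longrightarrow> \<Phi> ((S - T) \<union> (T - S))"
      and \<Phi>_det: "\<And>xs. length xs = n \<Longrightarrow> (\<And>i. i < n \<Longrightarrow> \<Phi> (g (xs ! i))) \<Longrightarrow> det_mod2 n g xs = 0"
      and \<Phi>_xy: "\<Phi> (g x)" "\<Phi> (g y)" "\<And>i. i < m \<Longrightarrow> \<Phi> {i}"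
    for x y v \<Phi>
  proof -
    define K where "K = {x \<in> carrier A. \<Phi> (g x)}"
    let ?B = "A\<lparr>carrier := K\<rparr>"
    have K: "subgroup K A"
      unfolding A_def
      by (rule symdiff_subgroup[OF inj]) (auto simp: K_def g_one g_mult \<Phi> simp flip: A_def)
    have B: "comm_group ?B"
      using A.subgroup_imp_group[OF K] by (rule group.group_comm_groupI) (auto simp: K_def A.m_comm)
    have Bm: "monoid ?B" using B by (simp add: comm_group.axioms comm_monoid.axioms)
    have fgB: "fg_abelian_group ?B"
      using B by (rule finite_imp_fg_abelian_group) (simp add: K_def carr)
    have xyK: "x \<in> carrier ?B" "y \<in> carrier ?B" using x y \<Phi>_xy by (auto simp: K_def)
    have preK: "set pre \<subseteq> carrier ?B"
      using \<Phi>_xy(3) by (auto simp: K_def pre_def carr g_e n)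
    have "torsion_cycle ?B x y \<in> bar_cycles 3 ?B"
      using keys_torsion_cycle[OF Bm xyK] bar_boundary_torsion_cycle[OF B xyK] sq by (simp add: bar_cycles_def)
    then have "?I (torsion_cycle ?B x y) \<in> bar_cycles n ?B"
      using shuffle_prod_cycle[OF B preK] pre(2) n by simp
    moreover have "torsion_cycle ?B x y = torsion_cycle A x y"
      by (simp add: torsion_cycle_def doubling_chain_def)
    moreover have "det_mod2 n g xs = 0" if "length xs = n" "set xs \<subseteq> K" for xs
    proof (rule \<Phi>_det)
      fix i assume "i < n"
      then have "xs ! i \<in> K" using that nth_mem by blast
      then show "\<Phi> (g (xs ! i))" by (simp add: K_def)
    qed (rule that)
    ultimately show ?thesis
      using natural_transformation_vanishes_on_subgroup[OF nat fgA K fgB g_mult _ _ v] by simp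
  qed
  obtain w where w: "Poly_Mapping.keys w \<subseteq> tuples 4 A"
    "shuffle (frag_of [a]) (shuffle (frag_of [b]) (frag_of [c]))
       = torsion_cycle A a (b \<otimes>\<^bsub>A\<^esub> c) - torsion_cycle A a b - torsion_cycle A a c + bar_boundary A w"
    using triple_product_polarization[OF A abc sq sq sq] by blast
  \<comment> \<open>The letters \<open>E\<close> and \<open>T\<close> stand for cycles of degree \<open>n\<close>: the product of the basis, and the torsion
    cycles multiplied by the basis vectors that precede \<open>a\<close>.\<close>
  let ?Tbc = "?I (torsion_cycle A a (b \<otimes>\<^bsub>A\<^esub> c))" and ?Tb = "?I (torsion_cycle A a b)"
    and ?Tc = "?I (torsion_cycle A a c)"
  let ?E = "shuffle_prod es (frag_of [])"
  have I_add: "?I (x + y) = ?I x + ?I y" for x y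
    using shuffle_prod_diff[of pre "x + y" y] by simp
  have "?E = ?Tbc - ?Tb - ?Tc + ?I (bar_boundary A w)"
    by (simp only: es_def shuffle_prod_append shuffle_prod.simps shuffle_Nil w(2) I_add shuffle_prod_diff)
  moreover have "?I (bar_boundary A w) \<in> bar_boundaries n A"
    using shuffle_prod_boundary[OF A pre(1) bar_boundariesI[of w 3 A]] w(1) pre(2) n by simp
  ultimately have sum_eq: "homology_class n A (?E + ?Tb + ?Tc) = homology_class n A ?Tbc"
    by (intro homology_class_eqI) simp
  have cyc: "?E \<in> bar_cycles n A"
    using shuffle_prod_cycle[OF A es(1) empty_word_cycle] es(2) by simp
  have Tcyc: "?I (torsion_cycle A x y) \<in> bar_cycles n A" if "x \<in> carrier A" "y \<in> carrier A" for x y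
  proof -
    have "torsion_cycle A x y \<in> bar_cycles 3 A"
      using that keys_torsion_cycle[OF A.monoid_axioms] bar_boundary_torsion_cycle[OF A] sq
      by (simp add: bar_cycles_def)
    then show ?thesis
      using shuffle_prod_cycle[OF A pre(1)] pre(2) n by simp
  qed
  let ?h = "homology_class n A" and ?F = "free_Abelian_group (tuples n A)"
  have hom: "\<tau> A \<in> hom (group_homology n A) (exterior_power n A)"
    using nat fgA by (simp add: natural_transformation_def)
  have \<tau>_add: "\<tau> A (?h (x + y)) = \<tau> A (?h x) <#>\<^bsub>?F\<^esub> \<tau> A (?h y)"
    if "x \<in> bar_cycles n A" "y \<in> bar_cycles n A" for x y
    using hom_mult[OF hom, of "?h x" "?h y"] that
    by (simp add: carrier_group_homology homology_class_add exterior_power_def)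
  have nonempty: "\<exists>v. v \<in> \<tau> A (?h x)" if "x \<in> bar_cycles n A" for x
  proof -
    have "\<tau> A (?h x) \<in> carrier (exterior_power n A)"
      using hom that by (auto simp: hom_def carrier_group_homology)
    then show ?thesis
      using diff_closedD(1)[OF diff_closed_exterior_relations[OF A.monoid_axioms, of n]]
      by (auto simp: exterior_power_def carrier_FactGroup r_coset_additive[OF mult_free_Abelian_group_eq])
  qed
  have Es: "frag_of es \<in> \<tau> A (?h ?E)"
  proof -
    have es_keys: "Poly_Mapping.keys (frag_of es) \<subseteq> tuples n A"
      using es by (simp add: tuples_def)
    let ?\<omega> = "exterior_relations n A #>\<^bsub>?F\<^esub> frag_of es"
    have "?\<omega> \<in> carrier (exterior_power n A)"
      unfolding exterior_power_def carrier_FactGroup using es_keys by auto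
    then have "\<tau> A (?h ?E) = ?\<omega>"
      using retract[OF fgA] exterior_to_homology_class[OF A es_keys] by fastforce
    then show ?thesis
      using diff_closedD(1)[OF diff_closed_exterior_relations[OF A.monoid_axioms, of n]]
      by (auto simp: r_coset_additive[OF mult_free_Abelian_group_eq] image_iff)
  qed
  have bc: "b \<otimes>\<^bsub>A\<^esub> c \<in> carrier A" using abc by simp
  \<comment> \<open>Adding the two classes with negative sign to the other side of the polarization identity expresses
    the remaining one as a product of cosets, in which \<open>es + u + v\<close> lies.\<close>
  obtain u v where u: "u \<in> \<tau> A (?h ?Tb)" and v: "v \<in> \<tau> A (?h ?Tc)"
    using nonempty[OF Tcyc[OF abc(1,2)]] nonempty[OF Tcyc[OF abc(1,3)]] by blast
  have "?E + ?Tb \<in> bar_cycles n A"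
    using diff_closedD(4)[OF diff_closed_bar_cycles cyc Tcyc] abc by simp
  then have "\<tau> A (?h ?Tbc) = (\<tau> A (?h ?E) <#>\<^bsub>?F\<^esub> \<tau> A (?h ?Tb)) <#>\<^bsub>?F\<^esub> \<tau> A (?h ?Tc)"
    unfolding sum_eq[symmetric] by (simp only: \<tau>_add cyc Tcyc abc)
  then have "frag_of es + u + v \<in> \<tau> A (?h ?Tbc)"
    using Es u v by (auto simp: set_mult_def)
  then have "det_chain n g (frag_of es + u + v) = 0"
    by (rule vanishes[OF abc(1) bc _, where \<Phi> = "\<lambda>S. m + 1 \<in> S \<longleftrightarrow> m + 2 \<in> S"])
      (auto simp: g_abc g_mult abc n intro: det_mod2_equal_coordinates[of "m + 1" _ "m + 2"])
  moreover have "det_chain n g u = 0"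
    by (rule vanishes[OF abc(1) abc(2) u, where \<Phi> = "\<lambda>S. m + 2 \<notin> S"])
      (auto simp: g_abc n intro: det_mod2_zero_coordinate[of "m + 2"])
  moreover have "det_chain n g v = 0"
    by (rule vanishes[OF abc(1) abc(3) v, where \<Phi> = "\<lambda>S. m + 1 \<notin> S"])
      (auto simp: g_abc n intro: det_mod2_zero_coordinate[of "m + 1"])
  moreover have "det_chain n g (frag_of es) = 1"
    using det_mod2_identity[of n g es] g_es by simp
  ultimately show False by simp
qed

end
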